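(* Let $F:\mathbb{R}\to\mathbb{R}$ be an increasing real-analytic diffeomorphism such that $F-\mathrm{Id}$ is $1$-periodic. For $t\in\mathbb{R}$ let $F_t(x)=F(x)+t$ for $x\in\mathbb{R}$. Assume that $\mathrm{Trans}(F)=\theta\in\mathbb{R}\setminus\mathbb{Q}$ and that there is a Herman ring associated to $F$, of modulus $2\tau$. Let $p_n/q_n$ be the $n$-th continued fraction convergent of $\theta$, and let $\ell_{p_n/q_n}$ be the length of the interval $\{t\in\mathbb{R} : \mathrm{Trans}(F_t)=p_n/q_n\}$. Then $$\limsup_{n\to\infty}\frac{1}{q_n}\log \ell_{p_n/q_n}\le -2\pi\tau .$$
   Context: For an increasing homeomorphism $F$ of $\mathbb{R}$ with $F-\mathrm{Id}$ $1$-periodic, the translation number is $\mathrm{Trans}(F):=\lim_{n\to+\infty}\frac{F^{\circ n}-\mathrm{Id}}{n}$ (the limit exists uniformly on $\mathbb{R}$ and is a constant). The function $t\mapsto \mathrm{Trans}(F_t)$ is continuous and non-decreasing, so for each rational $p/q$ the set $\{t\in\mathbb{R}:\mathrm{Trans}(F_t)=p/q\}$ is a closed interval, possibly reduced to a point. Convention: $\log 0=-\infty$. Convergents $p_n/q_n$ are written in lowest terms with $q_n\ge 1$. When $\mathrm{Trans}(F)=\theta$ is irrational, the maps $\frac1N\sum_{k=0}^{N-1}(F^{\circ k}-k\theta)$ converge on $\mathbb{R}$ as $N\to+\infty$ to an increasing homeomorphism $\Phi_F:\mathbb{R}\to\mathbb{R}$ satisfying $\Phi_F(x+1)=\Phi_F(x)+1$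 and $\Phi_F\circ F=\Phi_F+\theta$. Herman ring: one says that there is a Herman ring associated to $F$ if $\Phi_F$ is an analytic diffeomorphism of $\mathbb{R}$. For $s>0$ put $S(s)=\{z\in\mathbb{C}: -s<\mathrm{Im}(z)<s\}$. Let $\tau>0$ be the largest number such that $\Psi_F:=\Phi_F^{-1}$ extends to a univalent (injective holomorphic) map on $S(\tau)$. The set $\Psi_F(S(\tau))$ is called the Herman strip of $F$, its image in $\mathbb{C}/\mathbb{Z}$ is the Herman ring associated to $F$, and the modulus of the Herman ring is $2\tau$. *)

theory Defs
  imports "HOL-Analysis.Analysis"
begin

definition real_analytic :: "(real \<Rightarrow> real) \<Rightarrow> bool" where
  "real_analytic f \<longleftrightarrow>
     (\<forall>x. \<exists>r>0. \<exists>a::nat \<Rightarrow> real. \<forall>y. \<bar>y - x\<bar> < r \<longrightarrow> (\<lambda>n. a n * (y - x) ^ n) sums f y)"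

definition real_analytic_diffeo :: "(real \<Rightarrow> real) \<Rightarrow> bool" where
  "real_analytic_diffeo f \<longleftrightarrow> bij f \<and> real_analytic f \<and> real_analytic (inv f)"

definition trans_num :: "(real \<Rightarrow> real) \<Rightarrow> real" where
  "trans_num F =
     (THE \<theta>. uniform_limit UNIV (\<lambda>n x. ((F ^^ n) x - x) / real n) (\<lambda>_. \<theta>) sequentially)"

definition lin_map :: "(real \<Rightarrow> real) \<Rightarrow> real \<Rightarrow> real" where
  "lin_map F x =
     lim (\<lambda>N. (1 / real N) * (\<Sum>k<N. (F ^^ k) x - real k * trans_num F))"

definition has_herman_ring :: "(real \<Rightarrow> real) \<Rightarrow> bool" where
  "has_herman_ring F \<longleftrightarrow> real_analytic_diffeo (lin_map F)"

text \<open>Strips may have infinite half-width: if \<open>F\<close> is a translation, the inverse of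
  \<open>lin_map F\<close> extends univalently to all of \<open>\<complex>\<close> and no real half-width is largest.\<close>

definition strip :: "ereal \<Rightarrow> complex set" where
  "strip s = {z. ereal \<bar>Im z\<bar> < s}"

definition extends_univalently :: "(real \<Rightarrow> real) \<Rightarrow> ereal \<Rightarrow> bool" where
  "extends_univalently \<psi> s \<longleftrightarrow>
     (\<exists>g. g holomorphic_on strip s \<and> inj_on g (strip s) \<and>
          (\<forall>x::real. g (complex_of_real x) = complex_of_real (\<psi> x)))"

definition herman_ring_modulus :: "(real \<Rightarrow> real) \<Rightarrow> ereal \<Rightarrow> bool" where
  "herman_ring_modulus F m \<longleftrightarrow>
     (\<exists>\<tau>>0. m = 2 * \<tau> \<and> extends_univalently (inv (lin_map F)) \<tau> \<and>
        (\<forall>s>0. extends_univalently (inv (lin_map F)) s \<longrightarrow> s \<le> \<tau>))"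

text \<open>The value of \<open>[a\<^sub>0; a\<^sub>1, \<dots>, a\<^sub>n]\<close>, where \<open>a\<^sub>0, a\<^sub>1, \<dots>\<close> are the partial quotients of \<open>\<theta>\<close>;
  only meant for irrational \<open>\<theta>\<close>.\<close>

primrec cf_convergent :: "nat \<Rightarrow> real \<Rightarrow> real" where
  "cf_convergent 0 \<theta> = of_int \<lfloor>\<theta>\<rfloor>"
| "cf_convergent (Suc n) \<theta> = of_int \<lfloor>\<theta>\<rfloor> + 1 / cf_convergent n (1 / frac \<theta>)"

definition locking_set :: "(real \<Rightarrow> real) \<Rightarrow> real \<Rightarrow> real set" where
  "locking_set F r = {t. trans_num (\<lambda>x. F x + t) = r}"

text \<open>The logarithm of a nonnegative real, with \<open>log 0 = -\<infinity>\<close>; the library has \<open>ln 0 = 0\<close>.\<close>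

definition elog :: "real \<Rightarrow> ereal" where
  "elog x = (if x = 0 then -\<infinity> else ereal (ln x))"

end

theory Submission
  imports Defs "HOL-Complex_Analysis.Complex_Analysis"
begin

text \<open>Write \<open>g\<close> for the extension of \<open>\<Phi>\<^sub>F\<^sup>-\<^sup>1\<close> to the strip and \<open>G\<^sub>t(z) = g\<^sup>-\<^sup>1(g(z + \<theta>) + t)\<close>, which is
  \<open>F\<^sub>t\<close> in the linearising coordinate; \<open>G\<^sub>t\<close> is \<open>O(t)\<close>-close to the rotation by \<open>\<theta>\<close> on every smaller
  strip. If \<open>p/q\<close> is a convergent, the Birkhoff sums of length \<open>q\<close> of \<open>1/g'\<close> are of order \<open>q\<close>
  throughout the strip, so for every complex \<open>z\<close> the equation \<open>G\<^sub>t\<^sup>q(z) = z + p\<close> has exactly one solution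
  \<open>t = t(z)\<close> with \<open>\<bar>t\<bar> \<le> \<epsilon>/(2q)\<close>, and \<open>t(z)\<close> is holomorphic. Its values on the real line cover the
  set of locked parameters. The function \<open>t(z)\<close> is invariant under \<open>z \<mapsto> G\<^bsub>t(z)\<^esub>(z)\<close>, whose \<open>q\<close>-th
  iterate is the translation by \<open>p\<close>; averaging over the orbit conjugates this map to the translation
  by \<open>p/q\<close>. In the new coordinate \<open>t\<close> is therefore \<open>1/q\<close>-periodic and bounded on a strip of half-width
  \<open>s\<close> arbitrarily close to \<open>\<tau>\<close>, and hence oscillates by at most \<open>O(exp (- 2 \<pi> s q))\<close> on the real line.\<close>

text \<open>Two scalings keep every constant independent of p/q. With |t| of order 1/q, an orbit of
  length q stays within a small bounded distance of the rotation orbit, so the strip loses a fixed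
  width and not one growing with q. And in the q-th iterate the term linear in t has size q |t|
  while the remainder has size (q |t|)^2, so the linear term wins once \<epsilon> is small. In the
  original coordinate t(z) is only known to be 1-periodic, which would give no more than exp(-2 pi
  s). The factor q in the exponent comes from the second period p/q in the linearised coordinate,
  because 1 and p/q together generate 1/q. The lower bound for the Birkhoff sums has to hold in the
  whole strip, where 1/g' is complex and has no sign. It comes from the real line by comparing
  Riemann sums at different base points. Each analytic step costs some width, and a multiplicative
  constant remains in front of the exponential. Both are paid for by working with s < b < \<tau> and
  letting s tend to \<tau> at the end.\<close>

section \<open>Continued fraction convergents\<close>

text \<open>Since \<open>cf_convergent\<close> recurses on the first partial quotient, the induction
  peels that one off and carries the Moebius representation of \<theta> by the complete quotient
  \<open>x\<close>, with determinant of modulus 1. The clause for \<theta> > 1 is what makes the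
  denominators grow: in the step it is applied to \<open>y\<close>, whose numerator \<open>P\<close>
  becomes the new denominator.\<close>

lemma cf_convergent_moebius:
  fixes \<theta> :: real
  assumes "\<theta> \<notin> \<rat>"
  shows "\<exists>(P::int) (Q::int) (P'::int) (Q'::int). \<exists>x::real. x > 1
     \<and> \<theta> * (real_of_int Q * x + real_of_int Q') = real_of_int P * x + real_of_int P'
     \<and> \<bar>P * Q' - P' * Q\<bar> = 1
     \<and> Q \<ge> 1 \<and> Q \<ge> int n \<and> Q' \<ge> 0 \<and> cf_convergent n \<theta> = real_of_int P / real_of_int Q
     \<and> (\<theta> > 1 \<longrightarrow> P \<ge> int n + 1 \<and> P' \<ge> 0)"
  using assms
proof (induction n arbitrary: \<theta>)
  case 0
  have fr: "frac \<theta> > 0" "frac \<theta> < 1"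
    using 0 by (auto simp: frac_gt_0_iff frac_lt_1 Ints_subset_Rats[THEN subsetD])
  have "\<theta> = of_int \<lfloor>\<theta>\<rfloor> + frac \<theta>" by (simp add: frac_def)
  then have "\<theta> * (1 * (1 / frac \<theta>) + 0) = of_int \<lfloor>\<theta>\<rfloor> * (1 / frac \<theta>) + 1"
    using fr by (simp add: field_simps)
  moreover have "1 / frac \<theta> > 1" using fr by simp
  moreover have "\<theta> > 1 \<longrightarrow> \<lfloor>\<theta>\<rfloor> \<ge> 1" by linarith
  ultimately show ?case
    by (intro exI[of _ "\<lfloor>\<theta>\<rfloor>"] exI[of _ 1] exI[of _ 1] exI[of _ 0] exI[of _ "1 / frac \<theta>"]) auto
next
  case (Suc n)
  define y where "y = 1 / frac \<theta>"
  have fr: "frac \<theta> > 0" "frac \<theta> < 1"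
    using Suc.prems by (auto simp: frac_gt_0_iff frac_lt_1 Ints_subset_Rats[THEN subsetD])
  have y1: "y > 1" using fr by (simp add: y_def)
  have th: "\<theta> = of_int \<lfloor>\<theta>\<rfloor> + 1 / y" by (simp add: frac_def y_def)
  have "y \<notin> \<rat>"
  proof
    assume "y \<in> \<rat>"
    then have "of_int \<lfloor>\<theta>\<rfloor> + 1 / y \<in> \<rat>" by auto
    with th Suc.prems show False by simp
  qed
  from Suc.IH[OF this] obtain P Q P' Q' :: int and x :: real where *:
    "x > 1" "y * (Q * x + Q') = P * x + P'" "\<bar>P * Q' - P' * Q\<bar> = 1"
    "Q \<ge> 1" "Q' \<ge> 0" "cf_convergent n y = P / Q" "P \<ge> int n + 1" "P' \<ge> 0"
    using y1 by blast
  define a where "a = \<lfloor>\<theta>\<rfloor>"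
  have "\<theta> * (P * x + P') = (a * P + Q) * x + (a * P' + Q')"
  proof -
    have "\<theta> * y = a * y + 1" using y1 by (subst th) (simp add: field_simps a_def)
    then have "(\<theta> * y) * (Q * x + Q') = (a * y + 1) * (Q * x + Q')" by simp
    then have "\<theta> * (y * (Q * x + Q')) = a * (y * (Q * x + Q')) + (Q * x + Q')"
      by (simp add: algebra_simps)
    then show ?thesis unfolding *(2) by (simp add: algebra_simps)
  qed
  moreover have "\<bar>(a * P + Q) * P' - (a * P' + Q') * P\<bar> = 1"
  proof -
    have "(a * P + Q) * P' - (a * P' + Q') * P = - (P * Q' - P' * Q)" by (simp add: algebra_simps)
    then show ?thesis using *(3) by simp
  qed
  moreover have "cf_convergent (Suc n) \<theta> = (a * P + Q) / P"
    using *(4,7) by (simp add: y_def[symmetric] a_def *(6) add_divide_distrib)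
  moreover have "\<theta> > 1 \<longrightarrow> a * P + Q \<ge> int (Suc n) + 1 \<and> a * P' + Q' \<ge> 0"
  proof
    assume "\<theta> > 1"
    then have "a \<ge> 1" unfolding a_def by linarith
    then have "a * P \<ge> P" using *(7) by (simp add: mult_le_cancel_right1)
    moreover have "a * P' \<ge> 0" using \<open>a \<ge> 1\<close> *(8) by simp
    ultimately show "a * P + Q \<ge> int (Suc n) + 1 \<and> a * P' + Q' \<ge> 0" using *(4,5,7) by linarith
  qed
  ultimately show ?case using *(1,7,8)
    by (intro exI[of _ "a * P + Q"] exI[of _ P] exI[of _ "a * P' + Q'"] exI[of _ P'] exI[of _ x]) auto
qed

text \<open>The determinant shows that \<open>P / Q\<close> is reduced, hence equal to the given
  fraction term by term, and it also gives |q \<theta> - p| = 1 / (q x + Q') with q x + Q' \<ge> q.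
  The second conclusion makes the denominators tend to infinity.\<close>

lemma cf_convergent_approximation:
  fixes \<theta> :: real and p q :: int
  assumes irr: "\<theta> \<notin> \<rat>" and eq: "p / q = cf_convergent n \<theta>" and cop: "coprime p q" and q: "q \<ge> 1"
  shows "\<bar>q * \<theta> - p\<bar> \<le> 1 / q" and "q \<ge> int n"
proof -
  from cf_convergent_moebius[OF irr, of n] obtain P Q P' Q' :: int and x :: real where *:
    "x > 1" "\<theta> * (Q * x + Q') = P * x + P'" "\<bar>P * Q' - P' * Q\<bar> = 1"
    "Q \<ge> 1" "Q \<ge> int n" "Q' \<ge> 0" "cf_convergent n \<theta> = P / Q"
    by blast
  have "coprime P Q"
  proof (rule coprimeI)
    fix c assume "c dvd P" "c dvd Q"
    then have "c dvd \<bar>P * Q' - P' * Q\<bar>" by simp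
    with *(3) show "is_unit c" by simp
  qed
  have "real_of_int p * Q = P * q" using eq *(4,7) q by (simp add: field_simps)
  then have "p * Q = P * q" by (metis of_int_eq_iff of_int_mult)
  then have "\<bar>p\<bar> = \<bar>P\<bar> \<and> \<bar>Q\<bar> = \<bar>q\<bar>"
    using coprime_crossproduct_int[of p q P Q] cop \<open>coprime P Q\<close>
    by (simp flip: abs_mult)
  then have Q: "Q = q" using *(4) q by simp
  with \<open>p * Q = P * q\<close> q have P: "P = p" by simp
  show "q \<ge> int n" using * Q by simp
  have pos: "q * x + Q' \<ge> q"
  proof -
    have "real_of_int q * x \<ge> real_of_int q * 1" using *(1) q by (intro mult_left_mono) auto
    with *(6) show ?thesis by simp
  qed
  have "(q * \<theta> - p) * (q * x + Q') = P' * Q - P * Q'"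
  proof -
    have "(q * \<theta> - p) * (q * x + Q') = q * (\<theta> * (q * x + Q')) - p * (q * x + Q')"
      by (simp add: algebra_simps)
    also have "\<dots> = P' * Q - P * Q'"
      using *(2) by (simp add: Q P algebra_simps)
    finally show ?thesis .
  qed
  then have "\<bar>q * \<theta> - p\<bar> * \<bar>q * x + Q'\<bar> = 1"
    using *(3) by (metis abs_minus_commute abs_mult of_int_1 of_int_abs of_int_diff of_int_mult)
  then have "\<bar>q * \<theta> - p\<bar> = 1 / (q * x + Q')"
    using pos q by (simp add: field_simps)
  also have "\<dots> \<le> 1 / q" using pos q by (intro divide_left_mono) auto
  finally show "\<bar>q * \<theta> - p\<bar> \<le> 1 / q" .
qed

section \<open>Translation numbers and linearisation\<close>

locale circle_map =
  fixes F :: "real \<Rightarrow> real"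
  assumes mono: "mono F" and shift: "F (x + 1) = F x + 1"
begin

lemma mono_funpow: "mono (F ^^ n)"
  by (rule mono_pow[OF mono])

lemma funpow_shift: "(F ^^ n) (x + 1) = (F ^^ n) x + 1"
  by (induction n) (auto simp: shift)

lemma funpow_shift_int: "(F ^^ n) (x + of_int k) = (F ^^ n) x + of_int k"
proof (induction k rule: int_induct[where k = 0])
  case (step1 i)
  then show ?case using funpow_shift[of n "x + of_int i"] by (simp add: algebra_simps)
next
  case (step2 i)
  then show ?case using funpow_shift[of n "x + of_int (i - 1)"] by (simp add: algebra_simps)
qed simp

text \<open>An iterate commutes with integer translations, so monotonicity squeezes its value at
  \<open>x\<close> between its values at the integers around \<open>x\<close>.\<close>

lemma funpow_displacement: "\<bar>(F ^^ n) x - x - (F ^^ n) 0\<bar> \<le> 1"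
proof -
  have "(F ^^ n) (0 + of_int \<lfloor>x\<rfloor>) \<le> (F ^^ n) x"
    by (rule monoD[OF mono_funpow]) simp
  moreover have "(F ^^ n) x \<le> (F ^^ n) (0 + of_int (\<lfloor>x\<rfloor> + 1))"
    by (rule monoD[OF mono_funpow]) simp
  ultimately show ?thesis unfolding funpow_shift_int by simp linarith
qed

lemma funpow_mult_displacement: "\<bar>(F ^^ (n * m)) 0 - m * (F ^^ n) 0\<bar> \<le> m"
proof (induction m)
  case (Suc m)
  have "(F ^^ (n * Suc m)) 0 = (F ^^ n) ((F ^^ (n * m)) 0)"
    by (simp add: funpow_add)
  with funpow_displacement[of n "(F ^^ (n * m)) 0"] Suc show ?case
    by (simp add: algebra_simps)
qed simp

text \<open>F^n(0)/n and F^m(0)/m are both close to F^(nm)(0)/(nm), which makes the sequence Cauchy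
  with rate 1/n. The 2 is 1 for the orbit of 0 plus 1 for the passage from 0 to \<open>x\<close>.
  The bound on the deviation does not grow with n; this is stronger than convergence and is what the
  later arguments use.\<close>

lemma translation_number_exists: "\<exists>\<rho>::real. \<forall>n x. \<bar>(F ^^ n) x - x - n * \<rho>\<bar> \<le> 2"
proof -
  define b where "b n = (F ^^ n) 0 / n" for n
  have one: "\<bar>b (n * m) - b n\<bar> \<le> 1 / n" if "n > 0" "m > 0" for n m
  proof -
    have "b (n * m) - b n = ((F ^^ (n * m)) 0 - m * (F ^^ n) 0) / (n * m)"
      using that by (simp add: b_def field_simps)
    also have "\<bar>\<dots>\<bar> \<le> m / (n * m)"
      using funpow_mult_displacement[of n m] that
      by (simp only: abs_divide abs_of_nat) (rule divide_right_mono, auto)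
    finally show ?thesis using that by simp
  qed
  have two: "\<bar>b n - b m\<bar> \<le> 1 / n + 1 / m" if "n > 0" "m > 0" for n m
    using one[of n m] one[of m n] that by (simp add: mult.commute)
  have "Cauchy b"
  proof (rule metric_CauchyI)
    fix e :: real assume "e > 0"
    obtain N :: nat where N: "2 / e < N" using reals_Archimedean2 by blast
    have "N > 0" using N \<open>e > 0\<close> by (metis divide_pos_pos less_trans of_nat_0_less_iff zero_less_numeral)
    show "\<exists>M. \<forall>m\<ge>M. \<forall>n\<ge>M. dist (b m) (b n) < e"
    proof (intro exI allI impI)
      fix m n assume mn: "N \<le> m" "N \<le> n"
      have "dist (b m) (b n) \<le> 1 / m + 1 / n"
        using two[of m n] mn \<open>N > 0\<close> by (simp add: dist_real_def)
      also have "\<dots> \<le> 1 / N + 1 / N"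
        using mn \<open>N > 0\<close> by (intro add_mono divide_left_mono) auto
      also have "\<dots> < e" using N \<open>N > 0\<close> \<open>e > 0\<close> by (simp add: field_simps)
      finally show "dist (b m) (b n) < e" .
    qed
  qed
  then obtain \<rho> where \<rho>: "b \<longlonglongrightarrow> \<rho>" by (auto simp: Cauchy_convergent_iff convergent_def)
  have "\<bar>b n - \<rho>\<bar> \<le> 1 / n" if "n > 0" for n
  proof (rule LIMSEQ_le)
    show "(\<lambda>m. \<bar>b n - b m\<bar>) \<longlonglongrightarrow> \<bar>b n - \<rho>\<bar>" by (intro tendsto_intros \<rho>)
    show "(\<lambda>m. 1 / n + 1 / real m) \<longlonglongrightarrow> 1 / n"
      using tendsto_add[OF tendsto_const lim_1_over_n, of "1 / n"] by simp
    show "\<exists>N. \<forall>m\<ge>N. \<bar>b n - b m\<bar> \<le> 1 / n + 1 / real m"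
      using two[OF that] by (intro exI[of _ 1]) auto
  qed
  then have 3: "\<bar>(F ^^ n) 0 - n * \<rho>\<bar> \<le> 1" if "n > 0" for n
  proof -
    have "(F ^^ n) 0 - n * \<rho> = n * (b n - \<rho>)"
      using that by (simp add: b_def right_diff_distrib)
    then have "\<bar>(F ^^ n) 0 - n * \<rho>\<bar> = n * \<bar>b n - \<rho>\<bar>"
      by (simp add: abs_mult)
    also have "\<dots> \<le> n * (1 / n)"
      using \<open>\<And>n. n > 0 \<Longrightarrow> \<bar>b n - \<rho>\<bar> \<le> 1 / n\<close>[OF that] by (intro mult_left_mono) auto
    finally show ?thesis using that by simp
  qed
  have "\<bar>(F ^^ n) x - x - n * \<rho>\<bar> \<le> 2" for n x
    using 3[of n] funpow_displacement[of n x] by (cases "n = 0") auto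
  then show ?thesis by blast
qed

text \<open>Unlocks the \<open>THE\<close> in \<open>trans_num\<close>: the bounded deviation gives
  the uniform limit, and uniqueness is read off at one point.\<close>

lemma funpow_trans_num: "\<bar>(F ^^ n) x - x - n * trans_num F\<bar> \<le> 2"
proof -
  obtain \<rho> :: real where \<rho>: "\<And>n x. \<bar>(F ^^ n) x - x - n * \<rho>\<bar> \<le> 2"
    using translation_number_exists by blast
  let ?P = "\<lambda>\<theta>. uniform_limit UNIV (\<lambda>n x. ((F ^^ n) x - x) / real n) (\<lambda>_. \<theta>) sequentially"
  have lim: "?P \<rho>"
  proof (rule uniform_limitI)
    fix e :: real assume "e > 0"
    have "\<forall>\<^sub>F n in sequentially. 2 / real n < e \<and> n > 0"
      using \<open>e > 0\<close> by (intro eventually_conj order_tendstoD[OF lim_const_over_n] eventually_gt_at_top)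
    then show "\<forall>\<^sub>F n in sequentially. \<forall>x\<in>UNIV. dist (((F ^^ n) x - x) / real n) \<rho> < e"
    proof eventually_elim
      case (elim n)
      show ?case
      proof
        fix x
        have "((F ^^ n) x - x) / real n - \<rho> = ((F ^^ n) x - x - n * \<rho>) / n"
          using elim by (simp add: field_simps)
        also have "\<bar>\<dots>\<bar> \<le> 2 / n"
          using \<rho>[of n x] by (simp add: abs_divide divide_right_mono)
        finally show "dist (((F ^^ n) x - x) / real n) \<rho> < e"
          using elim by (simp add: dist_real_def)
      qed
    qed
  qed
  have "trans_num F = \<rho>" unfolding trans_num_def
  proof (rule the_equality[where P = ?P, OF lim])
    fix \<theta> assume "?P \<theta>"
    from tendsto_uniform_limitI[OF this, of 0] tendsto_uniform_limitI[OF lim, of 0]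
    show "\<theta> = \<rho>" using LIMSEQ_unique by force
  qed
  with \<rho> show ?thesis by simp
qed

text \<open>Otherwise \<phi> is continuous, 1-periodic and free of zeros, hence of one sign and
  bounded away from 0 by some \<open>m\<close>. Then n blocks of q iterates deviate from n p by at
  least n m, against the uniform bound 2.\<close>

lemma periodic_point:
  fixes p :: int and q :: nat
  assumes cont: "continuous_on UNIV F" and tn: "trans_num F = p / q" and q: "q > 0"
  shows "\<exists>x::real. (F ^^ q) x = x + p"
proof (rule ccontr)
  assume no: "\<not> ?thesis"
  define \<phi> where "\<phi> x = (F ^^ q) x - x - p" for x
  have contq: "continuous_on UNIV (F ^^ k)" for k
  proof (induction k)
    case (Suc k)
    then show ?case using continuous_on_compose[OF Suc, of F] continuous_on_subset[OF cont]
      by (simp add: comp_def)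
  qed (simp add: id_def)
  have cont\<phi>: "continuous_on UNIV \<phi>" unfolding \<phi>_def
    by (intro continuous_intros contq)
  have nz: "\<phi> x \<noteq> 0" for x using no by (auto simp: \<phi>_def algebra_simps)
  have conn: "connected (range \<phi>)"
    by (rule connected_continuous_image[OF cont\<phi>]) simp
  obtain m where m: "m > 0" "\<And>x. x \<in> {0..1} \<Longrightarrow> m \<le> \<bar>\<phi> x\<bar>"
  proof -
    have "\<exists>y\<in>{0..1}. \<forall>x\<in>{0..1}. \<bar>\<phi> y\<bar> \<le> \<bar>\<phi> x\<bar>"
      by (intro continuous_attains_inf continuous_intros continuous_on_subset[OF cont\<phi>]) auto
    then obtain y where "\<forall>x\<in>{0..1}. \<bar>\<phi> y\<bar> \<le> \<bar>\<phi> x\<bar>" by blast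
    with nz[of y] show ?thesis by (intro that[of "\<bar>\<phi> y\<bar>"]) auto
  qed
  have m': "m \<le> \<bar>\<phi> x\<bar>" for x
  proof -
    have "\<phi> x = \<phi> (frac x)"
      using funpow_shift_int[of q "frac x" "\<lfloor>x\<rfloor>"] by (simp add: \<phi>_def frac_def)
    with m(2)[of "frac x"] show ?thesis by (simp add: frac_lt_1 less_imp_le)
  qed
  have sgn: "(\<forall>x. \<phi> x > 0) \<or> (\<forall>x. \<phi> x < 0)"
  proof (rule ccontr)
    assume "\<not> ?thesis"
    then obtain x y where "\<phi> x \<le> 0" "\<phi> y \<ge> 0" by (meson not_less)
    then have "0 \<in> range \<phi>" using connectedD_interval[OF conn, of "\<phi> x" "\<phi> y" 0] by blast
    then show False using nz by (metis imageE)
  qed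
  have "n * m \<le> \<bar>(F ^^ (q * n)) 0 - n * p\<bar>" for n :: nat
  proof -
    have step: "(F ^^ (q * Suc n)) 0 = \<phi> ((F ^^ (q * n)) 0) + (F ^^ (q * n)) 0 + p" for n
      by (simp add: funpow_add \<phi>_def)
    from sgn show ?thesis
    proof
      assume *: "\<forall>x. \<phi> x > 0"
      have "n * m \<le> (F ^^ (q * n)) 0 - n * p"
      proof (induction n)
        case (Suc n)
        then show ?case using m'[of "(F ^^ (q * n)) 0"] *[rule_format, of "(F ^^ (q * n)) 0"] step[of n]
          by (simp add: algebra_simps del: mult_Suc_right)
      qed simp
      then show ?thesis by simp
    next
      assume *: "\<forall>x. \<phi> x < 0"
      have "n * m \<le> - ((F ^^ (q * n)) 0 - n * p)"
      proof (induction n)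
        case (Suc n)
        then show ?case using m'[of "(F ^^ (q * n)) 0"] *[rule_format, of "(F ^^ (q * n)) 0"] step[of n]
          by (simp add: algebra_simps del: mult_Suc_right)
      qed simp
      then show ?thesis by simp
    qed
  qed
  moreover have "\<bar>(F ^^ (q * n)) 0 - n * p\<bar> \<le> 2" for n :: nat
    using funpow_trans_num[of "q * n" 0] q by (simp add: tn mult.commute)
  ultimately have "n * m \<le> 2" for n :: nat by (meson order_trans)
  moreover obtain n :: nat where "2 < n * m" using \<open>m > 0\<close> reals_Archimedean3 by blast
  ultimately show False by (meson not_less)
qed

section \<open>Orbit averages and the conjugacy with the rotation\<close>

context
  fixes \<theta> :: real
  assumes tn: "trans_num F = \<theta>" and bij: "bij (lin_map F)"
begin

definition orbit_average :: "nat \<Rightarrow> real \<Rightarrow> real" where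
  "orbit_average N x = (1 / real N) * (\<Sum>k<N. (F ^^ k) x - real k * trans_num F)"

lemma orbit_average_shift: "N > 0 \<Longrightarrow> orbit_average N (x + 1) = orbit_average N x + 1"
  unfolding orbit_average_def funpow_shift by (simp add: sum.distrib sum_subtractf field_simps)

text \<open>Where the averages diverge, \<open>lin_map F\<close> takes one and the same junk value; the set of
  these points is invariant under \<open>x \<mapsto> x + 1\<close>, so injectivity forces it to be empty.\<close>

lemma orbit_average_tendsto: "(\<lambda>N. orbit_average N x) \<longlonglongrightarrow> lin_map F x"
proof -
  have "convergent (\<lambda>N. orbit_average N x)"
  proof (rule ccontr)
    assume *: "\<not> ?thesis"
    have "\<not> convergent (\<lambda>N. orbit_average N (x + 1))"
    proof
      assume "convergent (\<lambda>N. orbit_average N (x + 1))"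
      then obtain L where L: "(\<lambda>N. orbit_average N (x + 1)) \<longlonglongrightarrow> L" by (auto simp: convergent_def)
      have "(\<lambda>N. orbit_average N (x + 1) - 1) \<longlonglongrightarrow> L - 1" by (intro tendsto_intros L)
      then have "(\<lambda>N. orbit_average N x) \<longlonglongrightarrow> L - 1"
        by (rule Lim_transform_eventually)
           (use orbit_average_shift in \<open>auto intro!: eventually_sequentiallyI[of 1]\<close>)
      with * show False by (auto simp: convergent_def)
    qed
    with * have "(\<lambda>L. (\<lambda>N. orbit_average N x) \<longlonglongrightarrow> L) = (\<lambda>L. (\<lambda>N. orbit_average N (x + 1)) \<longlonglongrightarrow> L)"
      by (auto simp: convergent_def)
    then have "lin_map F x = lin_map F (x + 1)"
      by (simp add: lin_map_def lim_def orbit_average_def)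
    with bij have "x = x + 1" by (blast dest: bij_is_inj injD)
    then show False by simp
  qed
  then show ?thesis by (simp add: convergent_LIMSEQ_iff lin_map_def orbit_average_def)
qed

lemma lin_map_shift: "lin_map F (x + 1) = lin_map F x + 1"
proof (rule LIMSEQ_unique[OF orbit_average_tendsto])
  have "(\<lambda>N. orbit_average N x + 1) \<longlonglongrightarrow> lin_map F x + 1"
    by (intro tendsto_intros orbit_average_tendsto)
  then show "(\<lambda>N. orbit_average N (x + 1)) \<longlonglongrightarrow> lin_map F x + 1"
    by (rule Lim_transform_eventually)
       (use orbit_average_shift in \<open>auto intro!: eventually_sequentiallyI[of 1]\<close>)
qed

text \<open>Passing from \<open>x\<close> to \<open>F x\<close> shifts the orbit by one index, so
  the two averages differ by \<theta> and a boundary term, which is O(1/N) because the deviation is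
  bounded.\<close>

lemma lin_map_conj: "lin_map F (F x) = lin_map F x + \<theta>"
proof (rule LIMSEQ_unique[OF orbit_average_tendsto])
  have eq: "orbit_average N (F x) = orbit_average N x + \<theta> + ((F ^^ N) x - x - N * \<theta>) / N" if "N > 0" for N
  proof -
    have "(\<Sum>k<N. (F ^^ k) (F x) - real k * \<theta>) = (\<Sum>k<N. (F ^^ Suc k) x - real (Suc k) * \<theta>) + N * \<theta>"
      by (simp add: funpow_swap1 sum.distrib sum_subtractf algebra_simps)
    also have "(\<Sum>k<N. (F ^^ Suc k) x - real (Suc k) * \<theta>) =
        (\<Sum>k<N. (F ^^ k) x - real k * \<theta>) + ((F ^^ N) x - N * \<theta> - x)"
    proof (induction N)
      case (Suc N)
      then show ?case by (simp only: sum.lessThan_Suc)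
    qed simp
    finally have "orbit_average N (F x) = (1 / N) * ((\<Sum>k<N. (F ^^ k) x - real k * \<theta>) + ((F ^^ N) x - N * \<theta> - x) + N * \<theta>)"
      unfolding orbit_average_def tn by simp
    also have "\<dots> = orbit_average N x + \<theta> + ((F ^^ N) x - x - N * \<theta>) / N"
      unfolding orbit_average_def tn using that by (simp add: distrib_left diff_divide_distrib)
    finally show ?thesis .
  qed
  have "(\<lambda>N. ((F ^^ N) x - x - N * \<theta>) / N) \<longlonglongrightarrow> 0"
  proof (rule Lim_null_comparison)
    show "\<forall>\<^sub>F N in sequentially. norm (((F ^^ N) x - x - N * \<theta>) / N) \<le> 2 / real N"
      using funpow_trans_num[of _ x] by (auto simp: tn abs_divide divide_right_mono)
  qed (rule lim_const_over_n)
  from tendsto_add[OF tendsto_add[OF orbit_average_tendsto[of x] tendsto_const[of \<theta>]] this]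
  have "(\<lambda>N. orbit_average N x + \<theta> + ((F ^^ N) x - x - N * \<theta>) / N) \<longlonglongrightarrow> lin_map F x + \<theta>"
    by simp
  then show "(\<lambda>N. orbit_average N (F x)) \<longlonglongrightarrow> lin_map F x + \<theta>"
    by (rule Lim_transform_eventually) (use eq in \<open>auto intro!: eventually_sequentiallyI[of 1]\<close>)
qed

lemma lin_map_strict_mono: "strict_mono (lin_map F)"
proof -
  have "mono (lin_map F)"
  proof (rule monoI)
    fix x y :: real assume "x \<le> y"
    have "orbit_average N x \<le> orbit_average N y" for N
      unfolding orbit_average_def
      by (intro mult_left_mono sum_mono diff_right_mono monoD[OF mono_funpow] \<open>x \<le> y\<close>) auto
    then show "lin_map F x \<le> lin_map F y"
      by (intro LIMSEQ_le[OF orbit_average_tendsto orbit_average_tendsto]) auto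
  qed
  with bij show ?thesis by (simp add: strict_mono_iff_mono bij_is_inj)
qed

end

end

section \<open>Holomorphic functions on horizontal strips\<close>

lemma in_strip_iff [simp]: "z \<in> strip (ereal b) \<longleftrightarrow> \<bar>Im z\<bar> < b"
  by (simp add: strip_def)

lemma open_strip: "open (strip (ereal b))"
proof -
  have "strip (ereal b) = {z. Im z < b} \<inter> {z. Im z > - b}" by (auto simp: abs_less_iff)
  then show ?thesis by (auto intro: open_halfspace_Im_lt open_halfspace_Im_gt)
qed

lemma convex_strip: "convex (strip (ereal b))"
proof -
  have "strip (ereal b) = {z. Im z < b} \<inter> {z. Im z > - b}" by (auto simp: abs_less_iff)
  then show ?thesis by (auto intro: convex_Int convex_halfspace_Im_lt convex_halfspace_Im_gt)
qed

lemma strip_near: "z \<in> strip (ereal b)" if "w \<in> strip (ereal c)" "norm (z - w) \<le> b - c"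
  using that abs_Im_le_cmod[of "z - w"] by auto

text \<open>Cauchy's estimate on discs of radius \<open>d\<close>. The general convex set
  \<open>S\<close> allows its use both on strips in z and on a disc in the parameter t.\<close>

lemma holomorphic_lipschitz:
  assumes hol: "f holomorphic_on U" and U: "open U" and S: "convex S" and d: "d > 0"
    and sub: "\<And>x. x \<in> S \<Longrightarrow> cball x d \<subseteq> U"
    and B: "\<And>z. z \<in> U \<Longrightarrow> norm (f z) \<le> B" and zw: "z \<in> S" "w \<in> S"
  shows "norm (f z - f w) \<le> B / d * norm (z - w)"
proof (rule field_differentiable_bound[OF S _ _ zw])
  fix x assume x: "x \<in> S"
  have "x \<in> U" using sub[OF x] d by auto
  then have "(f has_field_derivative deriv f x) (at x)" by (rule holomorphic_derivI[OF hol U])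
  then show "(f has_field_derivative deriv f x) (at x within S)" by (rule has_field_derivative_at_within)
  have "norm ((deriv ^^ 1) f x) \<le> fact 1 * B / d ^ 1"
  proof (rule Cauchy_inequality[OF _ _ d])
    show "f holomorphic_on ball x d"
      using sub[OF x] by (intro holomorphic_on_subset[OF hol]) (use ball_subset_cball in blast)
    show "continuous_on (cball x d) f"
      by (intro holomorphic_on_imp_continuous_on holomorphic_on_subset[OF hol] sub x)
    fix y assume "norm (x - y) = d"
    then show "norm (f y) \<le> B" using sub[OF x] by (intro B) (auto simp: dist_norm)
  qed
  then show "norm (deriv f x) \<le> B / d" by simp
qed

lemma cball_subset_strip: "cball x d \<subseteq> strip (ereal (b + d))" if "x \<in> strip (ereal b)"
proof
  fix y assume "y \<in> cball x d"
  then show "y \<in> strip (ereal (b + d))"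
    using strip_near[OF that, of y "b + d"] by (simp add: dist_norm norm_minus_commute)
qed

lemma lipschitz_on_strip:
  assumes "f holomorphic_on strip (ereal (b + d))" "d > 0"
    and "\<And>z. z \<in> strip (ereal (b + d)) \<Longrightarrow> norm (f z) \<le> B"
    and "z \<in> strip (ereal b)" "w \<in> strip (ereal b)"
  shows "norm (f z - f w) \<le> B / d * norm (z - w)"
  using assms by (intro holomorphic_lipschitz[OF assms(1) open_strip convex_strip _ cball_subset_strip])

text \<open>With \<open>r = 1\<close> this covers periodicity and commutation with the unit
  translation; r = p/q is the second period of the resonant parameter in the linearised
  coordinate.\<close>

lemma shift_int_multiple:
  fixes f :: "complex \<Rightarrow> complex"
  assumes "\<And>z. z \<in> strip (ereal b) \<Longrightarrow> f (z + of_real r) = f z + c" and "z \<in> strip (ereal b)"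
  shows "f (z + of_int k * of_real r) = f z + of_int k * c"
proof (induction k rule: int_induct[where k = 0])
  case (step1 i)
  then show ?case using assms(1)[of "z + of_int i * of_real r"] assms(2) by (simp add: algebra_simps)
next
  case (step2 i)
  then show ?case using assms(1)[of "z + of_int (i - 1) * of_real r"] assms(2) by (simp add: algebra_simps)
qed simp

lemmas periodic_int_shift = shift_int_multiple[where r = 1, unfolded of_real_1 mult_1_right]

lemma unit_rectangle_representative:
  obtains w :: complex and k :: int
  where "z = w + of_int k" "Im w = Im z" "Re w \<in> {0..1}"
proof
  show "z = (z - of_int \<lfloor>Re z\<rfloor>) + of_int \<lfloor>Re z\<rfloor>" by simp
  show "Re (z - of_int \<lfloor>Re z\<rfloor>) \<in> {0..1}" by simp linarith
qed simp

lemma compact_unit_rectangle: "compact {z. Re z \<in> {0..1} \<and> \<bar>Im z\<bar> \<le> s}"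
proof -
  have "{z. Re z \<in> {0..1} \<and> \<bar>Im z\<bar> \<le> s} = cbox (Complex 0 (- s)) (Complex 1 s)"
    by (auto simp: in_cbox_complex_iff abs_le_iff)
  then show ?thesis by simp
qed

lemma periodic_bounded_on_strip:
  assumes cont: "continuous_on (strip (ereal b)) f"
    and per: "\<And>z. z \<in> strip (ereal b) \<Longrightarrow> f (z + 1) = f z" and sb: "s < b"
  obtains B where "B > 0" "\<And>z. \<bar>Im z\<bar> \<le> s \<Longrightarrow> norm (f z :: complex) \<le> B"
proof -
  let ?K = "{z. Re z \<in> {0..1} \<and> \<bar>Im z\<bar> \<le> s}"
  have "compact (f ` ?K)"
    using sb by (intro compact_continuous_image continuous_on_subset[OF cont] compact_unit_rectangle) auto
  then have "bounded (f ` ?K)" by (rule compact_imp_bounded)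
  then obtain B where B: "B > 0" "\<And>y. y \<in> f ` ?K \<Longrightarrow> norm y \<le> B"
    unfolding bounded_pos by blast
  show ?thesis
  proof (rule that[OF B(1)])
    fix z assume z: "\<bar>Im z\<bar> \<le> s"
    obtain w k where w: "z = w + of_int k" "Im w = Im z" "Re w \<in> {0..1}"
      by (rule unit_rectangle_representative)
    have "w \<in> strip (ereal b)" using w(2) z sb by simp
    then have "f (w + of_int k) = f w + of_int k * 0"
      by (intro periodic_int_shift[where b = b]) (simp_all add: per del: in_strip_iff)
    then have "f z = f w" by (simp add: w(1)[symmetric])
    moreover have "w \<in> ?K" using w(2,3) z by simp
    ultimately show "norm (f z) \<le> B" using B(2)[of "f w"] by simp
  qed
qed

section \<open>Exponentially small oscillation of periodic holomorphic functions\<close>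

text \<open>In the rectangle of width 1 the kernel has a single simple pole, at \<open>x\<close>,
  with residue 1 / (2 pi i). It is the 1-periodic counterpart of the Cauchy kernel and absorbs the
  usual factor 2 pi i.\<close>

lemma cauchy_periodic_kernel:
  fixes u :: "complex \<Rightarrow> complex" and a x s b :: real
  assumes hol: "u holomorphic_on strip (ereal b)" and s: "0 < s" "s < b" and x: "\<bar>x - a\<bar> < 1 / 2"
  shows "((\<lambda>w. u w / (exp (2 * pi * \<i> * (w - x)) - 1)) has_contour_integral u x)
           (rectpath (Complex (a - 1/2) (- s)) (Complex (a + 1/2) s))"
proof -
  define E where "E w = exp (2 * pi * \<i> * (w - x))" for w :: complex
  define S where "S = {w. Re w < x + 1} \<inter> {w. Re w > x - 1} \<inter> strip (ereal b)"
  have S: "convex S" "open S" unfolding S_def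
    by (auto intro!: convex_Int convex_halfspace_Re_lt convex_halfspace_Re_gt convex_strip
        open_Int open_halfspace_Re_lt open_halfspace_Re_gt open_strip)
  \<comment> \<open>The difference quotient of \<open>E\<close> at \<open>x\<close> with its
    removable singularity filled in. It has no zero in \<open>S\<close>, where \<open>E\<close>
    takes the value 1 only at \<open>x\<close>, so Cauchy's formula applies to the quotient of
    \<open>u\<close> by \<psi>.\<close>
  define \<psi> where "\<psi> = (\<lambda>w. if w = of_real x then deriv E (of_real x) else (E w - E (of_real x)) / (w - of_real x))"
  have Ex: "E (of_real x) = 1" by (simp add: E_def)
  have dE: "deriv E (of_real x) = 2 * pi * \<i>"
    unfolding E_def by (rule DERIV_imp_deriv) (auto intro!: derivative_eq_intros)
  have "\<psi> holomorphic_on S" unfolding \<psi>_def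
    by (intro pole_lemma_open S) (auto simp: E_def[abs_def] intro!: holomorphic_intros)
  moreover have \<psi>0: "\<psi> w \<noteq> 0" if "w \<in> S" for w
  proof (cases "w = of_real x")
    case False
    have "E w \<noteq> 1"
    proof
      assume "E w = 1"
      then obtain n :: int where "Im w = 0" and "2 * pi * (Re w - x) = of_int (2 * n) * pi"
        unfolding E_def exp_eq_1 by auto
      then have n: "Im w = 0" "Re w - x = of_int n" by simp_all
      moreover have "\<bar>Re w - x\<bar> < 1" using that by (auto simp: S_def)
      ultimately have "n = 0" by linarith
      with n False show False by (auto simp: complex_eq_iff)
    qed
    with False Ex show ?thesis by (simp add: \<psi>_def)
  qed (simp add: \<psi>_def dE)
  ultimately have hol': "(\<lambda>w. u w / \<psi> w) holomorphic_on S"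
    by (intro holomorphic_intros holomorphic_on_subset[OF hol]) (auto simp: S_def)
  let ?a = "Complex (a - 1/2) (- s)" and ?b = "Complex (a + 1/2) s"
  let ?\<gamma> = "rectpath ?a ?b"
  have box: "of_real x \<in> box ?a ?b" using s x by (auto simp: in_box_complex_iff abs_if split: if_splits)
  have sub: "path_image ?\<gamma> \<subseteq> S - {of_real x}"
  proof -
    have "path_image ?\<gamma> = cbox ?a ?b - box ?a ?b"
      by (rule path_image_rectpath_cbox_minus_box) (use s in auto)
    moreover have "cbox ?a ?b \<subseteq> S" using s x
      by (auto simp: S_def in_cbox_complex_iff abs_if split: if_splits)
    ultimately show ?thesis using box by auto
  qed
  have "((\<lambda>w. u w / \<psi> w / (w - of_real x)) has_contour_integral
      2 * pi * \<i> * winding_number ?\<gamma> (of_real x) * (u (of_real x) / \<psi> (of_real x))) ?\<gamma>"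
  proof (rule Cauchy_integral_formula_convex_simple[OF S(1) hol'])
    have "of_real x \<in> S" using s x by (auto simp: S_def)
    then show "of_real x \<in> interior S" using S by (simp add: interior_open)
  qed (use sub in auto)
  also have "2 * pi * \<i> * winding_number ?\<gamma> (of_real x) * (u (of_real x) / \<psi> (of_real x)) = u x"
    using winding_number_rectpath[OF box] by (simp add: \<psi>_def dE)
  finally show ?thesis
  proof (rule has_contour_integral_eq)
    fix w assume "w \<in> path_image ?\<gamma>"
    then have "w \<noteq> of_real x" using sub by auto
    then show "u w / \<psi> w / (w - of_real x) = u w / (exp (2 * pi * \<i> * (w - x)) - 1)"
      by (simp add: \<psi>_def Ex) (simp add: E_def)
  qed
qed

text \<open>The integrals over the vertical sides cancel by periodicity. On the bottom side the
  kernel is at most 1 / (exp(2 pi s) - 1). On the top side it is close to -1, and adding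
  \<open>u\<close> to the integrand leaves a term that is just as small; what was added is the
  integral of \<open>u\<close> over the top side, the same for all \<open>x\<close> in the
  window.\<close>

lemma periodic_strip_oscillation_aux:
  fixes u :: "complex \<Rightarrow> complex" and a s b B :: real
  assumes hol: "u holomorphic_on strip (ereal b)" and s: "0 < s" "s < b"
    and per: "\<And>w. w \<in> strip (ereal b) \<Longrightarrow> u (w + 1) = u w"
    and B: "\<And>w. w \<in> strip (ereal b) \<Longrightarrow> norm (u w) \<le> B"
  shows "\<exists>J. \<forall>x::real. \<bar>x - a\<bar> < 1 / 2 \<longrightarrow> norm (u x - J) \<le> 2 * (B / (exp (2 * pi * s) - 1))"
\<comment> \<open>The witness for \<open>J\<close> stays schematic until the last
  \<open>show\<close>, where it becomes the mean of \<open>u\<close> over the top side. It may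
  depend on \<open>a\<close> but not on \<open>x\<close>.\<close>
proof (intro exI allI impI)
  define a1 a2 a3 a4 where "a1 = Complex (a - 1/2) (- s)" and "a2 = Complex (a + 1/2) (- s)"
    and "a3 = Complex (a + 1/2) s" and "a4 = Complex (a - 1/2) s"
  note a_defs = a1_def a2_def a3_def a4_def
  fix x :: real assume x: "\<bar>x - a\<bar> < 1 / 2"
  define E where "E w = exp (2 * pi * \<i> * (w - x))" for w :: complex
  define h where "h w = u w / (E w - 1)" for w
  define D where "D = exp (2 * pi * s) - 1"
  have D: "D > 0" using s by (simp add: D_def)
  have B0: "B \<ge> 0" using s order_trans[OF norm_ge_zero B[of 0]] by simp
  have nE: "norm (E w) = exp (- 2 * pi * Im w)" for w
    by (simp add: E_def norm_exp_eq_Re)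
  have int: "(h has_contour_integral u x) (rectpath a1 a3)"
    using cauchy_periodic_kernel[OF hol s x] by (simp add: h_def[abs_def] E_def a_defs)
  have rect: "rectpath a1 a3 = linepath a1 a2 +++ linepath a2 a3 +++ linepath a3 a4 +++ linepath a4 a1"
    by (simp add: rectpath_def Let_def a_defs)
  have "h contour_integrable_on rectpath a1 a3" using int by (auto simp: contour_integrable_on_def)
  then have ci: "h contour_integrable_on linepath a1 a2" "h contour_integrable_on linepath a2 a3"
     "h contour_integrable_on linepath a3 a4" "h contour_integrable_on linepath a4 a1"
    unfolding rect by auto
  have sum: "u x = contour_integral (linepath a1 a2) h + contour_integral (linepath a2 a3) h
     + contour_integral (linepath a3 a4) h + contour_integral (linepath a4 a1) h"
    using contour_integral_unique[OF int] ci unfolding rect by (simp add: add.assoc)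
  have per_h: "h (w + 1) = h w" if "w \<in> strip (ereal b)" for w
  proof -
    have "E (w + 1) = exp (2 * pi * \<i> * (w - x) + 2 * pi * \<i>)" by (simp add: E_def algebra_simps)
    then have "E (w + 1) = E w" by (simp add: exp_add E_def)
    with per[OF that] show ?thesis by (simp add: h_def)
  qed
  have "contour_integral (linepath a2 a3) h = contour_integral (linepath a1 a4) h"
  proof -
    have "integral {0..1} (\<lambda>t. h (linepath a2 a3 t) * (a3 - a2)) =
       integral {0..1} (\<lambda>t. h (linepath a1 a4 t) * (a4 - a1))"
    proof (rule Henstock_Kurzweil_Integration.integral_cong)
      fix t :: real assume t: "t \<in> {0..1}"
      have "linepath a2 a3 t = linepath a1 a4 t + 1"
        by (simp add: linepath_def a_defs complex_eq_iff algebra_simps)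
      moreover have "linepath a1 a4 t \<in> strip (ereal b)"
      proof -
        have "linepath a1 a4 t \<in> closed_segment a1 a4" using t by (rule linepath_in_path)
        also have "\<dots> \<subseteq> strip (ereal b)"
          using s by (intro closed_segment_subset convex_strip) (auto simp: a_defs)
        finally show ?thesis .
      qed
      moreover have "a3 - a2 = a4 - a1" by (simp add: a_defs complex_eq_iff)
      ultimately show "h (linepath a2 a3 t) * (a3 - a2) = h (linepath a1 a4 t) * (a4 - a1)"
        using per_h by simp
    qed
    then show ?thesis by (simp add: contour_integral_integral)
  qed
  moreover have "contour_integral (linepath a4 a1) h = - contour_integral (linepath a1 a4) h"
    using contour_integral_reversepath[of "linepath a1 a4" h] by simp
  ultimately have sum': "u x = contour_integral (linepath a1 a2) h + contour_integral (linepath a3 a4) h"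
    using sum by simp
  have bot: "norm (contour_integral (linepath a1 a2) h) \<le> B / D * norm (a2 - a1)"
  proof (rule contour_integral_bound_linepath[OF ci(1)])
    show "0 \<le> B / D" using B0 D by simp
    fix w assume w: "w \<in> closed_segment a1 a2"
    then obtain t where "w = (1 - t) *\<^sub>R a1 + t *\<^sub>R a2" by (auto simp: in_segment)
    then have "Im w = (1 - t) * Im a1 + t * Im a2" by simp
    then have Im: "Im w = - s" by (simp add: a_defs algebra_simps)
    have "norm (E w - 1) \<ge> norm (E w) - norm (1::complex)" by (rule norm_triangle_ineq2)
    then have "D \<le> norm (E w - 1)" by (simp add: nE Im D_def)
    moreover have "norm (u w) \<le> B" using Im s by (intro B) auto
    ultimately show "norm (h w) \<le> B / D" unfolding h_def norm_divide
      using B0 D by (intro frac_le) auto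
  qed
  have cu: "u contour_integrable_on linepath a3 a4"
    using s by (intro contour_integrable_continuous_linepath holomorphic_on_imp_continuous_on
        holomorphic_on_subset[OF hol] closed_segment_subset convex_strip) (auto simp: a_defs)
  have top: "norm (contour_integral (linepath a3 a4) (\<lambda>w. h w + u w)) \<le> B / D * norm (a4 - a3)"
  proof (rule contour_integral_bound_linepath)
    show "(\<lambda>w. h w + u w) contour_integrable_on linepath a3 a4"
      by (intro contour_integrable_add ci cu)
    show "0 \<le> B / D" using B0 D by simp
    fix w assume w: "w \<in> closed_segment a3 a4"
    then obtain t where "w = (1 - t) *\<^sub>R a3 + t *\<^sub>R a4" by (auto simp: in_segment)
    then have "Im w = (1 - t) * Im a3 + t * Im a4" by simp
    then have Im: "Im w = s" by (simp add: a_defs algebra_simps)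
    define e where "e = exp (2 * pi * s)"
    have e: "e > 1" using s by (simp add: e_def)
    have nEw: "norm (E w) = 1 / e" by (simp add: nE Im e_def exp_minus field_simps)
    then have "E w \<noteq> 1" using e by auto
    then have eq: "h w + u w = u w * E w / (E w - 1)" by (simp add: h_def field_simps)
    have "norm (1 - E w) \<ge> norm (1::complex) - norm (E w)" by (rule norm_triangle_ineq2)
    then have ge: "1 - 1 / e \<le> norm (E w - 1)" by (simp add: nEw norm_minus_commute)
    have uB: "norm (u w) \<le> B" using Im s by (intro B) auto
    have "norm (h w + u w) = norm (u w) * (1 / e) / norm (E w - 1)"
      by (simp add: eq norm_divide norm_mult nEw)
    also have "\<dots> \<le> B * (1 / e) / (1 - 1 / e)"
      using e ge uB B0 by (intro frac_le mult_mono) auto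
    also have "\<dots> = B / (e - 1)" using e by (simp add: field_simps)
    also have "\<dots> = B / D" by (simp add: D_def e_def)
    finally show "norm (h w + u w) \<le> B / D" .
  qed
  have "contour_integral (linepath a3 a4) (\<lambda>w. h w + u w) =
      contour_integral (linepath a3 a4) h + contour_integral (linepath a3 a4) u"
    by (intro contour_integral_add ci cu)
  with sum' have "u x - (- contour_integral (linepath a3 a4) u) =
      contour_integral (linepath a1 a2) h + contour_integral (linepath a3 a4) (\<lambda>w. h w + u w)"
    by simp
  also have "norm \<dots> \<le> B / D * norm (a2 - a1) + B / D * norm (a4 - a3)"
    by (intro norm_triangle_mono bot top)
  also have "\<dots> = 2 * (B / D)"
  proof -
    have "a2 - a1 = 1" "a4 - a3 = -1" by (simp_all add: a_defs complex_eq_iff)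
    then show ?thesis by (simp only:) simp
  qed
  finally show "norm (u x - (- contour_integral (linepath (Complex (a + 1/2) s) (Complex (a - 1/2) s)) u))
     \<le> 2 * (B / (exp (2 * pi * s) - 1))"
    by (simp add: D_def a_defs)
qed

text \<open>The rescaled function \<open>v\<close> is 1-periodic on a strip \<open>q\<close> times
  as wide; this is the origin of the factor \<open>q\<close> in the exponent.\<close>

lemma periodic_strip_oscillation:
  fixes u :: "complex \<Rightarrow> complex" and q x y s b B :: real
  assumes hol: "u holomorphic_on strip (ereal b)" and s: "0 < s" "s < b" and q: "q > 0"
    and per: "\<And>w. w \<in> strip (ereal b) \<Longrightarrow> u (w + of_real (1 / q)) = u w"
    and B: "\<And>w. w \<in> strip (ereal b) \<Longrightarrow> norm (u w) \<le> B"
  shows "norm (u x - u y) \<le> 4 * (B / (exp (2 * pi * s * q) - 1))"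
proof -
  define v where "v w = u (w / of_real q)" for w
  have sc: "w / of_real q \<in> strip (ereal b)" if "w \<in> strip (ereal (q * b))" for w
    using that q by (simp add: field_simps)
  have v: "v holomorphic_on strip (ereal (q * b))" unfolding v_def
    by (rule holomorphic_on_compose_gen[OF _ hol, unfolded comp_def])
       (use sc q in \<open>auto intro!: holomorphic_intros simp del: in_strip_iff\<close>)
  have vper: "v (w + 1) = v w" if "w \<in> strip (ereal (q * b))" for w
    using per[OF sc[OF that]] by (simp add: v_def add_divide_distrib)
  have vB: "norm (v w) \<le> B" if "w \<in> strip (ereal (q * b))" for w
    unfolding v_def by (rule B[OF sc[OF that]])
  have "q * s > 0" "q * s < q * b" using s q by simp_all
  note osc = periodic_strip_oscillation_aux[OF v this vper vB]
  \<comment> \<open>The integer translation brings \<open>q * y\<close> within distance 1 of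
    \<open>q * x\<close>, so that both lie in the open window of radius 1/2 around their midpoint
    \<open>a\<close>. Two uses of the bound with factor 2 give the factor 4.\<close>
  define k where "k = \<lfloor>q * x - q * y\<rfloor>"
  define a where "a = (q * x + (q * y + k)) / 2"
  obtain J where J: "\<And>x::real. \<bar>x - a\<bar> < 1 / 2 \<Longrightarrow>
      norm (v x - J) \<le> 2 * (B / (exp (2 * pi * (q * s)) - 1))"
    using osc[of a] by blast
  have k: "\<bar>q * x - (q * y + k)\<bar> < 1" unfolding k_def by linarith
  have "\<bar>q * x - a\<bar> < 1 / 2" "\<bar>(q * y + k) - a\<bar> < 1 / 2"
    using k by (auto simp: a_def field_simps abs_if split: if_splits)
  from J[OF this(1)] J[OF this(2)]
  have "norm (v (of_real (q * x)) - v (of_real (q * y + k))) \<le> 4 * (B / (exp (2 * pi * (q * s)) - 1))"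
    using norm_triangle_ineq4[of "v (of_real (q * x)) - J" "v (of_real (q * y + k)) - J"] by simp
  moreover have "v (of_real (q * y + k)) = v (of_real (q * y))"
    using periodic_int_shift[of "q * b" v 0 "of_real (q * y)" k] vper s q by simp
  ultimately show ?thesis using q by (simp add: v_def mult_ac)
qed

text \<open>A contraction with parameter: the iterates starting at 0 converge uniformly with rate
  2^(-n), so the fixed point is holomorphic in \<open>w\<close>. The assumption \<open>hol\<close>
  tests \<open>K\<close> along holomorphic functions only, which keeps everything in one complex
  variable. It yields both the resonant parameter and the inverse of the linearising
  coordinate.\<close>

lemma holomorphic_fixed_point:
  fixes K :: "complex \<Rightarrow> complex \<Rightarrow> complex" and \<rho> :: real
  assumes W: "open W" and \<rho>: "\<rho> \<ge> 0"
    and self: "\<And>w t. w \<in> W \<Longrightarrow> norm t \<le> \<rho> \<Longrightarrow> norm (K w t) \<le> \<rho>"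
    and contr: "\<And>w t t'. w \<in> W \<Longrightarrow> norm t \<le> \<rho> \<Longrightarrow> norm t' \<le> \<rho> \<Longrightarrow>
        norm (K w t - K w t') \<le> 1 / 2 * norm (t - t')"
    and hol: "\<And>T. T holomorphic_on W \<Longrightarrow> (\<And>w. w \<in> W \<Longrightarrow> norm (T w) \<le> \<rho>) \<Longrightarrow>
        (\<lambda>w. K w (T w)) holomorphic_on W"
  obtains T where "T holomorphic_on W" "\<And>w. w \<in> W \<Longrightarrow> norm (T w) \<le> \<rho>"
    "\<And>w. w \<in> W \<Longrightarrow> K w (T w) = T w"
    "\<And>w t. w \<in> W \<Longrightarrow> norm t \<le> \<rho> \<Longrightarrow> K w t = t \<Longrightarrow> t = T w"
proof -
  have "\<exists>!t\<in>cball 0 \<rho>. K w t = t" if w: "w \<in> W" for w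
  proof (rule Banach_fix[where c = "1/2"])
    show "dist (K w x) (K w y) \<le> 1 / 2 * dist x y" if "x \<in> cball 0 \<rho>" "y \<in> cball 0 \<rho>" for x y
      using contr[OF w, of x y] that by (simp add: dist_norm)
    show "K w ` cball 0 \<rho> \<subseteq> cball 0 \<rho>" using self[OF w] by auto
  qed (use \<rho> in \<open>auto simp: complete_eq_closed\<close>)
  then obtain T where T: "\<And>w. w \<in> W \<Longrightarrow> norm (T w) \<le> \<rho>" "\<And>w. w \<in> W \<Longrightarrow> K w (T w) = T w"
    "\<And>w t. w \<in> W \<Longrightarrow> norm t \<le> \<rho> \<Longrightarrow> K w t = t \<Longrightarrow> t = T w"
    unfolding Ex1_def mem_cball_0 by (metis (no_types))
  define I where "I n w = (K w ^^ n) 0" for n w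
  have I: "I n holomorphic_on W \<and> (\<forall>w\<in>W. norm (I n w) \<le> \<rho>)" for n
  proof (induction n)
    case 0
    then show ?case using \<rho> by (simp add: I_def)
  next
    case (Suc n)
    have "I (Suc n) = (\<lambda>w. K w (I n w))" by (simp add: I_def fun_eq_iff)
    with Suc hol[of "I n"] self show ?case by auto
  qed
  have dist: "norm (I n w - T w) \<le> (1 / 2) ^ n * \<rho>" if w: "w \<in> W" for n w
  proof (induction n)
    case 0
    then show ?case using T(1)[OF w] by (simp add: I_def)
  next
    case (Suc n)
    have "norm (I (Suc n) w - T w) = norm (K w (I n w) - K w (T w))"
      using T(2)[OF w] by (simp add: I_def)
    also have "\<dots> \<le> 1 / 2 * norm (I n w - T w)" using I[of n] T(1)[OF w] w by (intro contr) auto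
    finally show ?case using Suc by simp
  qed
  have "T holomorphic_on W"
  proof (rule holomorphic_uniform_sequence[OF W])
    show "I n holomorphic_on W" for n using I by simp
    fix x assume x: "x \<in> W"
    then obtain d where d: "d > 0" "cball x d \<subseteq> W" using W open_contains_cball by blast
    have "uniform_limit (cball x d) I T sequentially"
    proof (rule uniform_limitI)
      fix e :: real assume "e > 0"
      have "(\<lambda>n. (1 / 2) ^ n * \<rho>) \<longlonglongrightarrow> 0 * \<rho>"
        by (intro tendsto_mult tendsto_const LIMSEQ_realpow_zero) auto
      then have "\<forall>\<^sub>F n in sequentially. (1 / 2) ^ n * \<rho> < e"
        using \<open>e > 0\<close> by (intro order_tendstoD[of _ "0 * \<rho>"]) auto
      then show "\<forall>\<^sub>F n in sequentially. \<forall>y\<in>cball x d. dist (I n y) (T y) < e"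
      proof eventually_elim
        case (elim n)
        then show ?case using dist[of _ n] d by (auto simp: dist_norm intro: le_less_trans)
      qed
    qed
    with d show "\<exists>d>0. cball x d \<subseteq> W \<and> uniform_limit (cball x d) I T sequentially" by blast
  qed
  with T show ?thesis using that by blast
qed

section \<open>Birkhoff sums along a rotation close to p/q\<close>

text \<open>Multiplication by \<open>p\<close> permutes the residues modulo \<open>q\<close>, so an
  orbit of the rational rotation consists of equally spaced points.\<close>

lemma sum_coprime_rotation:
  fixes f :: "complex \<Rightarrow> complex" and p :: int and q :: nat
  assumes cop: "coprime p (int q)" and q: "q > 0" and z: "z \<in> strip (ereal b)"
    and per: "\<And>z. z \<in> strip (ereal b) \<Longrightarrow> f (z + 1) = f z"
  shows "(\<Sum>k=1..q. f (z + of_nat k * of_int p / of_nat q)) = (\<Sum>j<q. f (z + of_nat j / of_nat q))"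
proof -
  define r where "r k = nat ((int k * p) mod int q)" for k
  have "inj_on r {1..q}"
  proof (rule inj_onI)
    fix k k' assume k: "k \<in> {1..q}" "k' \<in> {1..q}" and "r k = r k'"
    then have "(int k * p) mod int q = (int k' * p) mod int q"
      using q by (simp add: r_def eq_nat_nat_iff)
    then have "int q dvd (int k - int k') * p" by (simp add: mod_eq_dvd_iff left_diff_distrib)
    then have "int q dvd int k - int k'"
      using cop by (simp add: coprime_commute coprime_dvd_mult_left_iff)
    moreover have "\<bar>int k - int k'\<bar> < int q" using k by auto
    ultimately show "k = k'" using zdvd_imp_le[of "int q" "\<bar>int k - int k'\<bar>"] by force
  qed
  moreover have sub: "r ` {1..q} \<subseteq> {..<q}" using q by (auto simp: r_def nat_less_iff)
  ultimately have "r ` {1..q} = {..<q}" by (intro card_subset_eq) (auto simp: card_image)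
  with \<open>inj_on r {1..q}\<close> have bij: "bij_betw r {1..q} {..<q}" by (simp add: bij_betw_def)
  have "f (z + of_nat k * of_int p / of_nat q) = f (z + of_nat (r k) / of_nat q)" for k
  proof -
    define d where "d = (int k * p) div int q"
    have "int k * p = int (r k) + d * int q" using q by (simp add: r_def d_def)
    then have "(of_int (int k * p) :: complex) = of_int (int (r k) + d * int q)" by simp
    then have "of_nat k * of_int p / of_nat q = of_nat (r k) / of_nat q + (of_int d :: complex)"
      using q by (simp add: field_simps)
    then show ?thesis
      using periodic_int_shift[of b f 0 "z + of_nat (r k) / of_nat q" d] per z
      by (simp add: add.assoc Im_divide_of_nat)
  qed
  then have "(\<Sum>k=1..q. f (z + of_nat k * of_int p / of_nat q)) = (\<Sum>k=1..q. f (z + of_nat (r k) / of_nat q))"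
    by simp
  also have "\<dots> = (\<Sum>j<q. f (z + of_nat j / of_nat q))"
    by (rule sum.reindex_bij_betw[OF bij])
  finally show ?thesis .
qed

text \<open>Both sums are within \<open>K\<close> of q c, where \<open>c\<close> is the increment of
  a primitive over one period, that is, the mean of \<open>f\<close>. On each of the q subintervals
  the endpoint rule misses the increment of the primitive by at most K / q^2.\<close>

lemma riemann_sum_periodic:
  fixes f :: "complex \<Rightarrow> complex" and q :: nat
  assumes hol: "f holomorphic_on strip (ereal b)" and q: "q > 0"
    and per: "\<And>z. z \<in> strip (ereal b) \<Longrightarrow> f (z + 1) = f z"
    and lip: "\<And>z w. z \<in> strip (ereal b) \<Longrightarrow> w \<in> strip (ereal b) \<Longrightarrow> norm (f z - f w) \<le> K * norm (z - w)"
    and z: "z \<in> strip (ereal b)" and w: "w \<in> strip (ereal b)"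
  shows "norm ((\<Sum>j<q. f (z + of_nat j / of_nat q)) - (\<Sum>j<q. f (w + of_nat j / of_nat q))) \<le> 2 * K"
proof -
  let ?S = "strip (ereal b)"
  obtain Q where Q: "\<And>x. x \<in> ?S \<Longrightarrow> (Q has_field_derivative f x) (at x within ?S)"
    using holomorphic_convex_primitive'[OF convex_strip open_strip hol] by blast
  have K: "K \<ge> 0" using lip[of z "z + 1"] z by (simp add: order_trans[OF norm_ge_zero])
  have "\<exists>c. \<forall>x\<in>?S. Q (x + 1) - Q x = c"
  proof (rule has_field_derivative_zero_constant[OF convex_strip])
    fix x assume x: "x \<in> ?S"
    have "(Q has_field_derivative f (x + 1)) (at (x + 1))"
      using Q[of "x + 1"] x by (simp add: at_within_open[OF _ open_strip])
    then have "((\<lambda>x. Q (x + 1)) has_field_derivative f (x + 1)) (at x)"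
      by (simp only: DERIV_shift)
    from DERIV_diff[OF has_field_derivative_at_within[OF this, of ?S] Q[OF x]]
    have "((\<lambda>x. Q (x + 1) - Q x) has_field_derivative f (x + 1) - f x) (at x within ?S)" .
    then show "((\<lambda>x. Q (x + 1) - Q x) has_field_derivative 0) (at x within ?S)" by (simp add: per[OF x])
  qed
  then obtain c where c: "\<And>x. x \<in> ?S \<Longrightarrow> Q (x + 1) - Q x = c" by blast
  have "norm (of_nat q * c - (\<Sum>j<q. f (z + of_nat j / of_nat q))) \<le> K" if z: "z \<in> ?S" for z
  proof -
    let ?x = "\<lambda>j. z + of_nat j / of_nat q"
    have xS: "?x j \<in> ?S" for j using z by (simp add: Im_divide_of_nat)
    have step: "norm (Q (?x (Suc j)) - Q (?x j) - f (?x j) / of_nat q) \<le> K / q / q" for j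
    proof -
      let ?C = "closed_segment (?x j) (?x (Suc j))"
      have sub: "?C \<subseteq> ?S" by (intro closed_segment_subset xS convex_strip)
      have d: "?x (Suc j) - ?x j = 1 / of_nat q" using q by (simp add: field_simps)
      have "norm ((Q (?x (Suc j)) - f (?x j) * ?x (Suc j)) - (Q (?x j) - f (?x j) * ?x j))
          \<le> K / q * norm (?x (Suc j) - ?x j)"
      proof (rule field_differentiable_bound[where S = ?C and f' = "\<lambda>y. f y - f (?x j)"])
        fix y assume y: "y \<in> ?C"
        then have "(Q has_field_derivative f y) (at y within ?C)"
          using sub by (blast intro: DERIV_subset[OF Q])
        then show "((\<lambda>y. Q y - f (?x j) * y) has_field_derivative f y - f (?x j)) (at y within ?C)"
          by (auto intro!: derivative_eq_intros)
        have "norm (f y - f (?x j)) \<le> K * norm (y - ?x j)" using y sub xS by (intro lip) auto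
        also have "\<dots> \<le> K * norm (?x (Suc j) - ?x j)"
          using segment_bound[OF y] K by (intro mult_left_mono) (auto simp: norm_minus_commute)
        finally show "norm (f y - f (?x j)) \<le> K / q" unfolding d by (simp add: norm_divide)
      qed auto
      moreover have "(Q (?x (Suc j)) - f (?x j) * ?x (Suc j)) - (Q (?x j) - f (?x j) * ?x j)
          = Q (?x (Suc j)) - Q (?x j) - f (?x j) * (?x (Suc j) - ?x j)" by (simp add: algebra_simps)
      ultimately have "norm (Q (?x (Suc j)) - Q (?x j) - f (?x j) * (?x (Suc j) - ?x j))
          \<le> K / q * norm (?x (Suc j) - ?x j)" by (simp only:)
      then show ?thesis unfolding d by (simp add: norm_divide)
    qed
    have "(\<Sum>j<q. Q (?x (Suc j)) - Q (?x j)) = Q (?x q) - Q (?x 0)"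
      by (rule sum_lessThan_telescope)
    also have "\<dots> = c" using c[OF z] q by simp
    finally have "c - (\<Sum>j<q. f (?x j)) / of_nat q = (\<Sum>j<q. Q (?x (Suc j)) - Q (?x j) - f (?x j) / of_nat q)"
      by (simp add: sum_subtractf sum_divide_distrib)
    also have "norm \<dots> \<le> (\<Sum>j<q. K / q / q)" by (intro sum_norm_le step)
    also have "\<dots> = K / q" using q by simp
    finally have "real q * norm (c - (\<Sum>j<q. f (?x j)) / of_nat q) \<le> q * (K / q)"
      by (intro mult_left_mono) auto
    also have "real q * norm (c - (\<Sum>j<q. f (?x j)) / of_nat q) = norm (of_nat q * (c - (\<Sum>j<q. f (?x j)) / of_nat q))"
      by (simp only: norm_mult norm_of_nat)
    finally show ?thesis using q by (simp add: right_diff_distrib)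
  qed
  from this[OF z] this[OF w] show ?thesis
    using norm_triangle_ineq4[of "of_nat q * c - (\<Sum>j<q. f (w + of_nat j / of_nat q))"
        "of_nat q * c - (\<Sum>j<q. f (z + of_nat j / of_nat q))"] by simp
qed

text \<open>Riemann sums of a periodic function are within \<open>O(1)\<close> of a constant on the whole strip, so a
  lower bound on the real line propagates to the strip.\<close>

lemma birkhoff_sum_lower_bound:
  fixes f :: "complex \<Rightarrow> complex" and q :: nat and p :: int and \<theta> m K :: real
  assumes hol: "f holomorphic_on strip (ereal b)" and q: "q > 0" and b: "b > 0"
    and per: "\<And>z. z \<in> strip (ereal b) \<Longrightarrow> f (z + 1) = f z"
    and lip: "\<And>z w. z \<in> strip (ereal b) \<Longrightarrow> w \<in> strip (ereal b) \<Longrightarrow> norm (f z - f w) \<le> K * norm (z - w)"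
    and m: "\<And>x::real. Re (f x) \<ge> m" and cop: "coprime p (int q)" and approx: "\<bar>q * \<theta> - p\<bar> \<le> 1 / q"
    and z: "z \<in> strip (ereal b)"
  shows "norm (\<Sum>k=1..q. f (z + of_nat k * of_real \<theta>)) \<ge> q * m - 3 * K"
proof -
  have K: "K \<ge> 0" using lip[of z "z + 1"] z by (simp add: order_trans[OF norm_ge_zero])
  have "q * m = (\<Sum>j<q. m)" by simp
  also have "\<dots> \<le> (\<Sum>j<q. Re (f (0 + of_nat j / of_nat q)))"
    using m[of "real _ / real q"] by (intro sum_mono) simp
  also have "\<dots> = Re (\<Sum>j<q. f (0 + of_nat j / of_nat q))" by simp
  also have "\<dots> \<le> norm (\<Sum>j<q. f (0 + of_nat j / of_nat q))" by (rule complex_Re_le_cmod)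
  finally have 1: "q * m \<le> norm (\<Sum>j<q. f (0 + of_nat j / of_nat q))" .
  have 2: "norm ((\<Sum>j<q. f (0 + of_nat j / of_nat q)) - (\<Sum>j<q. f (z + of_nat j / of_nat q))) \<le> 2 * K"
    using b z by (intro riemann_sum_periodic[OF hol q per lip]) auto
  \<comment> \<open>Replacing k p/q by k \<theta> moves the k-th point by at most |q \<theta> - p|
    \<le> 1/q, so the q terms cost \<open>K\<close> together. With 2 K from the Riemann sums this
    makes the 3 K of the statement.\<close>
  have "norm ((\<Sum>k=1..q. f (z + of_nat k * of_int p / of_nat q)) - (\<Sum>k=1..q. f (z + of_nat k * of_real \<theta>))) \<le> K"
  proof -
    have "norm (\<Sum>k=1..q. f (z + of_nat k * of_int p / of_nat q) - f (z + of_nat k * of_real \<theta>)) \<le> (\<Sum>k=1..q. K / q)"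
    proof (rule sum_norm_le)
      fix k assume k: "k \<in> {1..q}"
      have "norm (f (z + of_nat k * of_int p / of_nat q) - f (z + of_nat k * of_real \<theta>))
          \<le> K * norm ((z + of_nat k * of_int p / of_nat q) - (z + of_nat k * of_real \<theta>))"
        using z by (intro lip) (auto simp: Im_divide_of_nat)
      also have "(z + of_nat k * of_int p / of_nat q) - (z + of_nat k * of_real \<theta>)
          = of_real (- (k / q) * (q * \<theta> - p))" using q by (simp add: field_simps)
      also have "norm \<dots> = k / q * \<bar>q * \<theta> - p\<bar>" by (simp only: norm_of_real abs_mult) simp
      also have "K * \<dots> \<le> K * (1 * (1 / q))"
        using k K q approx by (intro mult_left_mono mult_mono) auto
      finally show "norm (f (z + of_nat k * of_int p / of_nat q) - f (z + of_nat k * of_real \<theta>)) \<le> K / q"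
        by simp
    qed
    then show ?thesis using q by (simp add: sum_subtractf)
  qed
  then have 3: "norm ((\<Sum>j<q. f (z + of_nat j / of_nat q)) - (\<Sum>k=1..q. f (z + of_nat k * of_real \<theta>))) \<le> K"
    by (simp only: sum_coprime_rotation[where f = f, OF cop q z per])
  show ?thesis using 1 2 3
      norm_triangle_ineq2[of "\<Sum>j<q. f (0 + of_nat j / of_nat q)" "\<Sum>j<q. f (z + of_nat j / of_nat q)"]
      norm_triangle_ineq2[of "\<Sum>j<q. f (z + of_nat j / of_nat q)" "\<Sum>k=1..q. f (z + of_nat k * of_real \<theta>)"]
    by linarith
qed

section \<open>Perturbations of the rotation\<close>

text \<open>The interface through which the conjugated family enters: \<open>f\<close> is the
  derivative of \<open>A\<close> in t at t = 0. Holomorphy of \<open>A\<close> is required along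
  one-variable functions, the form in which \<open>holomorphic_fixed_point\<close> consumes it. All
  constants are fixed before p/q is chosen.\<close>

locale near_translation =
  fixes A :: "complex \<Rightarrow> complex \<Rightarrow> complex" and f :: "complex \<Rightarrow> complex"
    and \<theta> \<sigma> \<delta> K M B m :: real
  assumes \<sigma>_pos: "\<sigma> > 0" and \<delta>_pos: "\<delta> > 0" and m_pos: "m > 0"
    and f_hol: "f holomorphic_on strip (ereal \<sigma>)"
    and f_periodic: "\<And>z. z \<in> strip (ereal \<sigma>) \<Longrightarrow> f (z + 1) = f z"
    and f_lipschitz: "\<And>z w. z \<in> strip (ereal \<sigma>) \<Longrightarrow> w \<in> strip (ereal \<sigma>) \<Longrightarrow>
        norm (f z - f w) \<le> K * norm (z - w)"
    and f_bound: "\<And>z. z \<in> strip (ereal \<sigma>) \<Longrightarrow> norm (f z) \<le> B"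
    and f_real: "\<And>x::real. Re (f x) \<ge> m"
    and A_shift: "\<And>z t. z \<in> strip (ereal \<sigma>) \<Longrightarrow> norm t \<le> \<delta> \<Longrightarrow> A (z + 1) t = A z t + 1"
    and A_expansion: "\<And>z t. z \<in> strip (ereal \<sigma>) \<Longrightarrow> norm t \<le> \<delta> \<Longrightarrow>
        norm (A z t - z - f z * t) \<le> M * norm t ^ 2"
    and A_hol: "\<And>X a T. open X \<Longrightarrow> a holomorphic_on X \<Longrightarrow> T holomorphic_on X \<Longrightarrow>
        (\<And>x. x \<in> X \<Longrightarrow> a x \<in> strip (ereal \<sigma>)) \<Longrightarrow> (\<And>x. x \<in> X \<Longrightarrow> norm (T x) \<le> \<delta>) \<Longrightarrow>
        (\<lambda>x. A (a x) (T x)) holomorphic_on X"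
begin

definition G :: "complex \<Rightarrow> complex \<Rightarrow> complex" where
  "G t z = A (z + of_real \<theta>) t"

lemma iterate_Suc: "(G t ^^ Suc k) z = A ((G t ^^ k) z + of_real \<theta>) t"
  by (simp add: G_def[of t "(G t ^^ k) z"])

lemma K_nonneg: "K \<ge> 0"
  using f_lipschitz[of 0 1] \<sigma>_pos by (simp add: order_trans[OF norm_ge_zero])

lemma B_nonneg: "B \<ge> 0"
  using f_bound[of 0] \<sigma>_pos by (simp add: order_trans[OF norm_ge_zero])

lemma M_nonneg: "M \<ge> 0"
proof -
  have "0 \<le> M * norm (of_real \<delta> :: complex) ^ 2"
    using A_expansion[of 0 "of_real \<delta>"] \<sigma>_pos \<delta>_pos by (intro order_trans[OF norm_ge_zero]) auto
  then show ?thesis using \<delta>_pos by (simp add: zero_le_mult_iff)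
qed

text \<open>A bound for |A z t - z| / |t| when |t| \<le> \<delta>; the quadratic term is absorbed
  into the linear one.\<close>

definition speed :: real where "speed = B + M * \<delta>"

lemma speed_nonneg: "speed \<ge> 0"
  using B_nonneg M_nonneg \<delta>_pos by (simp add: speed_def)

lemma A_displacement:
  assumes "z \<in> strip (ereal \<sigma>)" "norm t \<le> \<delta>"
  shows "norm (A z t - z) \<le> speed * norm t"
proof -
  have "norm (A z t - z) \<le> norm (A z t - z - f z * t) + norm (f z * t)"
    using norm_triangle_ineq[of "A z t - z - f z * t" "f z * t"] by simp
  also have "\<dots> \<le> M * norm t ^ 2 + B * norm t"
    using A_expansion[OF assms] f_bound[OF assms(1)] by (simp add: norm_mult mult_right_mono add_mono)
  also have "M * norm t ^ 2 \<le> M * \<delta> * norm t"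
    using assms(2) M_nonneg by (simp add: power2_eq_square mult_left_mono mult_right_mono mult.assoc)
  finally show ?thesis by (simp add: speed_def algebra_simps)
qed

context
  fixes n :: nat and c r :: real
  assumes r: "r \<le> \<delta>" and room: "c + n * (speed * r) \<le> \<sigma>"
begin

text \<open>The two claims need each other in the induction: the next step can be estimated only
  while the orbit is in the strip of half-width \<sigma>, and the accumulated displacement keeps it
  there. The assumption \<open>room\<close> is the budget for \<open>n\<close> steps.\<close>

lemma iterate_displacement:
  assumes "z \<in> strip (ereal c)" "norm t \<le> r" "k \<le> n"
  shows "norm ((G t ^^ k) z - z - of_nat k * of_real \<theta>) \<le> k * (speed * norm t)
    \<and> (G t ^^ k) z \<in> strip (ereal \<sigma>)"
  using assms(3)
proof (induction k)
  case 0
  have "0 \<le> n * (speed * r)" using assms(2) speed_nonneg norm_ge_zero[of t]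
    by (intro mult_nonneg_nonneg) linarith+
  then show ?case using assms(1) room by auto
next
  case (Suc k)
  let ?w = "(G t ^^ k) z + of_real \<theta>"
  have "norm (A ?w t - ?w) \<le> speed * norm t"
    using Suc assms(2) r by (intro A_displacement) auto
  moreover have "(G t ^^ Suc k) z - z - of_nat (Suc k) * of_real \<theta> =
      ((G t ^^ k) z - z - of_nat k * of_real \<theta>) + (A ?w t - ?w)"
    by (simp add: G_def algebra_simps)
  ultimately have 1: "norm ((G t ^^ Suc k) z - z - of_nat (Suc k) * of_real \<theta>) \<le> Suc k * (speed * norm t)"
    using Suc norm_triangle_ineq[of "(G t ^^ k) z - z - of_nat k * of_real \<theta>" "A ?w t - ?w"]
    by (simp add: algebra_simps)
  also have "\<dots> \<le> n * (speed * r)"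
    using Suc.prems assms(2) speed_nonneg by (intro mult_mono mult_left_mono mult_nonneg_nonneg) auto
  finally have "\<bar>Im ((G t ^^ Suc k) z - z - of_nat (Suc k) * of_real \<theta>)\<bar> \<le> n * (speed * r)"
    using abs_Im_le_cmod order_trans by blast
  then have "(G t ^^ Suc k) z \<in> strip (ereal \<sigma>)" using assms(1) room by simp
  with 1 show ?case by blast
qed

text \<open>Each step costs M |t|^2 for the expansion of \<open>A\<close>, and at most K n speed
  |t|^2 for evaluating \<open>f\<close> on the true orbit and not on the rotation orbit. The sum
  starts at j = 1 because \<open>G\<close> rotates before it perturbs.\<close>

lemma iterate_expansion:
  assumes "z \<in> strip (ereal c)" "norm t \<le> r" "k \<le> n"
  shows "norm ((G t ^^ k) z - z - of_nat k * of_real \<theta> - t * (\<Sum>j=1..k. f (z + of_nat j * of_real \<theta>)))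
    \<le> k * ((K * n * speed + M) * norm t ^ 2)"
  using assms(3)
proof (induction k)
  case (Suc k)
  define w where "w = (G t ^^ k) z + of_real \<theta>"
  define v where "v = z + of_nat (Suc k) * of_real \<theta>"
  have wv: "w - v = (G t ^^ k) z - z - of_nat k * of_real \<theta>" by (simp add: w_def v_def algebra_simps)
  have w: "w \<in> strip (ereal \<sigma>)" using iterate_displacement[OF assms(1,2), of k] Suc.prems by (simp add: w_def)
  have v: "v \<in> strip (ereal \<sigma>)" using iterate_displacement[OF assms(1,2), of 0] by (simp add: v_def)
  have "norm (f w - f v) \<le> K * norm (w - v)" by (rule f_lipschitz[OF w v])
  also have "\<dots> \<le> K * (k * (speed * norm t))"
    unfolding wv using iterate_displacement[OF assms(1,2), of k] Suc.prems K_nonneg by (intro mult_left_mono) auto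
  also have "\<dots> \<le> K * (n * (speed * norm t))"
    using Suc.prems K_nonneg speed_nonneg by (intro mult_left_mono mult_right_mono) auto
  finally have "norm ((f w - f v) * t) \<le> K * (n * (speed * norm t)) * norm t"
    unfolding norm_mult by (intro mult_right_mono) auto
  moreover have "norm (A w t - w - f w * t) \<le> M * norm t ^ 2"
    using w assms(2) r by (intro A_expansion) auto
  ultimately have b: "norm ((A w t - w - f w * t) + (f w - f v) * t) \<le> (K * n * speed + M) * norm t ^ 2"
    by (intro order_trans[OF norm_triangle_ineq]) (simp add: algebra_simps power2_eq_square)
  have eq: "(G t ^^ Suc k) z - z - of_nat (Suc k) * of_real \<theta> - t * (\<Sum>j=1..Suc k. f (z + of_nat j * of_real \<theta>))
     = ((G t ^^ k) z - z - of_nat k * of_real \<theta> - t * (\<Sum>j=1..k. f (z + of_nat j * of_real \<theta>)))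
       + ((A w t - w - f w * t) + (f w - f v) * t)"
    unfolding iterate_Suc by (simp add: w_def v_def algebra_simps)
  have "norm ((G t ^^ Suc k) z - z - of_nat (Suc k) * of_real \<theta> - t * (\<Sum>j=1..Suc k. f (z + of_nat j * of_real \<theta>)))
      \<le> k * ((K * n * speed + M) * norm t ^ 2) + (K * n * speed + M) * norm t ^ 2"
    unfolding eq using Suc by (intro norm_triangle_mono b) auto
  then show ?case by (simp add: algebra_simps)
qed simp

lemma iterate_shift:
  assumes "z \<in> strip (ereal c)" "norm t \<le> r" "k \<le> n"
  shows "(G t ^^ k) (z + 1) = (G t ^^ k) z + 1"
  using assms(3)
proof (induction k)
  case (Suc k)
  have "(G t ^^ k) z + of_real \<theta> \<in> strip (ereal \<sigma>)"
    using iterate_displacement[OF assms(1,2), of k] Suc.prems by simp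
  then have "A ((G t ^^ k) z + of_real \<theta> + 1) t = A ((G t ^^ k) z + of_real \<theta>) t + 1"
    using assms(2) r by (intro A_shift) auto
  with Suc show ?case unfolding iterate_Suc by (simp add: add_ac)
qed simp

lemma iterate_holomorphic:
  assumes X: "open X" and a: "a holomorphic_on X" and T: "T holomorphic_on X"
    and ax: "\<And>x. x \<in> X \<Longrightarrow> a x \<in> strip (ereal c)" and Tx: "\<And>x. x \<in> X \<Longrightarrow> norm (T x) \<le> r" and "k \<le> n"
  shows "(\<lambda>x. (G (T x) ^^ k) (a x)) holomorphic_on X"
  using \<open>k \<le> n\<close>
proof (induction k)
  case (Suc k)
  have "(\<lambda>x. A ((G (T x) ^^ k) (a x) + of_real \<theta>) (T x)) holomorphic_on X"
  proof (rule A_hol[OF X _ T])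
    show "(\<lambda>x. (G (T x) ^^ k) (a x) + of_real \<theta>) holomorphic_on X"
      using Suc by (intro holomorphic_intros) auto
    show "(G (T x) ^^ k) (a x) + of_real \<theta> \<in> strip (ereal \<sigma>)" if "x \<in> X" for x
      using iterate_displacement[OF ax[OF that] Tx[OF that], of k] Suc.prems by simp
    show "norm (T x) \<le> \<delta>" if "x \<in> X" for x using Tx[OF that] r by simp
  qed
  then show ?case unfolding iterate_Suc .
qed (use a in simp)

end

end

section \<open>Solving for the parameter at which a point is periodic of type p/q\<close>

text \<open>Four collars of width \<open>d\<close> are spent from the outside in: on the q iterates,
  which start in the strip s + 3 d; on one step of \<open>advance\<close> and on Cauchy's estimate
  for \<open>correction\<close>, both on s + 2 d; on inverting \<open>linearizer\<close> over s + d;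
  and on the strict inequality s < s + d in the oscillation estimate. The conditions on \<epsilon>
  bound the displacement of q iterates by d/16 and make the quadratic remainder small against
  \<open>m\<close>. Those on \<open>q\<close> ensure q m - 3 K \<ge> q m / 2, 1/q \<le> d/16 and 1/q
  \<le> \<epsilon> m / 8.\<close>

locale near_resonance = near_translation +
  fixes d s \<epsilon> :: real and p :: int and q :: nat
  assumes d: "d > 0" and s: "s > 0" and sd: "s + 4 * d \<le> \<sigma>"
    and \<epsilon>: "\<epsilon> > 0" "\<epsilon> \<le> \<delta>" "16 * (speed * \<epsilon>) \<le> d" "16 * ((K * speed + M) * \<epsilon>) \<le> m"
    and q: "q > 0" "6 * K \<le> real q * m" "16 \<le> real q * d" "8 \<le> \<epsilon> * m * real q"
    and cop: "coprime p (int q)" and approx: "\<bar>real q * \<theta> - real_of_int p\<bar> \<le> 1 / real q"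
begin

abbreviation C :: real where "C \<equiv> K * speed + M"

text \<open>This scale makes the displacement after q iterates bounded independently of q. Solutions
  are sought for |t| \<le> \<rho>, whereas the iterates are controlled up to 2 \<rho>, which leaves
  room for Cauchy's estimate in t.\<close>

definition \<rho> :: real where "\<rho> = \<epsilon> / (2 * q)"

lemma \<rho>_pos: "\<rho> > 0" using \<epsilon> q by (simp add: \<rho>_def)

lemma q_\<rho>: "q * (2 * \<rho>) = \<epsilon>" using q by (simp add: \<rho>_def)

lemma \<rho>_le: "2 * \<rho> \<le> \<epsilon>"
proof -
  have "1 * (2 * \<rho>) \<le> q * (2 * \<rho>)" using q \<rho>_pos by (intro mult_right_mono) auto
  then show ?thesis using q_\<rho> by simp
qed

lemma C_nonneg: "C \<ge> 0" using K_nonneg speed_nonneg M_nonneg by simp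

lemma radius: "2 * \<rho> \<le> \<delta>" using \<rho>_le \<epsilon> by simp

lemma iterates_room: "(s + 3 * d) + real q * (speed * (2 * \<rho>)) \<le> \<sigma>"
proof -
  have "real q * (speed * (2 * \<rho>)) = speed * (real q * (2 * \<rho>))" by simp
  also have "\<dots> = speed * \<epsilon>" by (simp only: q_\<rho>)
  finally show ?thesis using \<epsilon>(3) sd d \<rho>_pos by linarith
qed

lemmas displacement = iterate_displacement[OF radius iterates_room]
lemmas expansion = iterate_expansion[OF radius iterates_room]
lemmas shift = iterate_shift[OF radius iterates_room]
lemmas holomorphic = iterate_holomorphic[OF radius iterates_room]

text \<open>By \<open>iterate_expansion\<close>, the derivative of the q-th iterate in t at t =
  0.\<close>

definition drift :: "complex \<Rightarrow> complex" where
  "drift z = (\<Sum>k=1..q. f (z + of_nat k * of_real \<theta>))"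

definition remainder :: "complex \<Rightarrow> complex \<Rightarrow> complex" where
  "remainder z t = (G t ^^ q) z - z - of_nat q * of_real \<theta> - t * drift z"

lemma strip_mono: "z \<in> strip (ereal \<sigma>)" if "z \<in> strip (ereal (s + 3 * d))"
  using that sd d by auto

lemma drift_lower_bound: "norm (drift z) \<ge> q * m / 2" if "z \<in> strip (ereal (s + 3 * d))"
  using birkhoff_sum_lower_bound[OF f_hol q(1) \<sigma>_pos f_periodic f_lipschitz f_real cop approx strip_mono[OF that]] q
  unfolding drift_def by simp

lemma drift_nonzero: "drift z \<noteq> 0" if "z \<in> strip (ereal (s + 3 * d))"
proof -
  have "q * m > 0" using q m_pos by simp
  then show ?thesis using drift_lower_bound[OF that] by auto
qed

lemma drift_holomorphic: "drift holomorphic_on strip (ereal (s + 3 * d))"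
  unfolding drift_def[abs_def]
proof (intro holomorphic_on_sum)
  fix k
  show "(\<lambda>z. f (z + of_nat k * of_real \<theta>)) holomorphic_on strip (ereal (s + 3 * d))"
    by (rule holomorphic_on_compose_gen[OF _ f_hol, unfolded comp_def])
       (use sd d in \<open>auto intro!: holomorphic_intros\<close>)
qed

lemma remainder_bound:
  assumes "z \<in> strip (ereal (s + 3 * d))" "norm t \<le> 2 * \<rho>"
  shows "norm (remainder z t) \<le> C * (q * norm t) ^ 2"
proof -
  have "norm (remainder z t) \<le> q * ((K * q * speed + M) * norm t ^ 2)"
    using expansion[OF assms, of q] by (simp add: remainder_def drift_def)
  also have "\<dots> \<le> q * ((q * C) * norm t ^ 2)"
  proof -
    have "M \<le> q * M" using q M_nonneg by (simp add: mult_le_cancel_right1)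
    then show ?thesis by (intro mult_left_mono mult_right_mono) (auto simp: algebra_simps)
  qed
  finally show ?thesis by (simp add: power2_eq_square algebra_simps)
qed

text \<open>Cauchy's estimate in the variable t. The constant is half of the lower bound q m / 2 for
  \<open>drift\<close>, which gives \<open>newton\<close> the contraction factor 1/2.\<close>

lemma remainder_lipschitz:
  assumes z: "z \<in> strip (ereal (s + 3 * d))" and t: "norm t \<le> \<rho>" "norm t' \<le> \<rho>"
  shows "norm (remainder z t - remainder z t') \<le> (q * m / 4) * norm (t - t')"
proof -
  have "norm (remainder z t - remainder z t') \<le> (C * \<epsilon>\<^sup>2) / (\<rho> / 2) * norm (t - t')"
  proof (rule holomorphic_lipschitz[where U = "ball 0 (2 * \<rho>)" and S = "cball 0 \<rho>"])
    have "(\<lambda>t. (G t ^^ q) z) holomorphic_on ball 0 (2 * \<rho>)"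
      by (rule holomorphic[where a = "\<lambda>_. z" and T = "\<lambda>t. t"]) (use z in auto)
    then show "remainder z holomorphic_on ball 0 (2 * \<rho>)" unfolding remainder_def[abs_def]
      by (intro holomorphic_intros)
    show "norm (remainder z t) \<le> C * \<epsilon>\<^sup>2" if "t \<in> ball 0 (2 * \<rho>)" for t
    proof -
      have "norm (remainder z t) \<le> C * (q * norm t) ^ 2" using that by (intro remainder_bound[OF z]) simp
      also have "\<dots> \<le> C * (q * (2 * \<rho>)) ^ 2"
        using that C_nonneg by (intro mult_left_mono power_mono) auto
      finally show ?thesis by (simp only: q_\<rho>)
    qed
    show "cball x (\<rho> / 2) \<subseteq> ball 0 (2 * \<rho>)" if "x \<in> cball 0 \<rho>" for x :: complex
    proof
      fix y :: complex assume "y \<in> cball x (\<rho> / 2)"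
      then have "norm (y - x) \<le> \<rho> / 2" by (simp add: dist_norm norm_minus_commute)
      then show "y \<in> ball 0 (2 * \<rho>)"
        using that norm_triangle_ineq[of "y - x" x] \<rho>_pos by simp
    qed
  qed (use t \<rho>_pos in auto)
  also have "(C * \<epsilon>\<^sup>2) / (\<rho> / 2) = 4 * q * (C * \<epsilon>)"
    using \<epsilon>(1) q by (simp add: \<rho>_def power2_eq_square field_simps)
  also have "\<dots> \<le> q * m / 4" using \<epsilon>(4) q by simp
  finally show ?thesis by (simp add: mult_right_mono)
qed

text \<open>A Newton step for the equation of periodicity with the slope frozen at its value for t =
  0.\<close>

definition newton :: "complex \<Rightarrow> complex \<Rightarrow> complex" where
  "newton z t = - (of_real (q * \<theta> - p) + remainder z t) / drift z"

lemma newton_fixed_iff: "newton z t = t \<longleftrightarrow> (G t ^^ q) z = z + of_int p"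
  if "z \<in> strip (ereal (s + 3 * d))"
proof -
  have "newton z t = t \<longleftrightarrow> - (of_real (q * \<theta> - p) + remainder z t) = t * drift z"
    using drift_nonzero[OF that] by (simp add: newton_def divide_eq_eq)
  also have "\<dots> \<longleftrightarrow> (G t ^^ q) z = z + of_int p"
    by (auto simp: remainder_def algebra_simps)
  finally show ?thesis .
qed

text \<open>At |t| = \<rho> the linear term outweighs the errors. The first form goes with the bound
  q m / 2 for |drift| in the strip and gives the self-map; the strict one goes with the bound q m
  for its real part on the real line and gives the signs in \<open>above_resonance\<close> and
  \<open>below_resonance\<close>.\<close>

lemma small_at_\<rho>: "1 / q + C * (q * \<rho>)\<^sup>2 \<le> q * m / 2 * \<rho>" "1 / q + C * (q * \<rho>)\<^sup>2 < q * m * \<rho>"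
proof -
  have q\<rho>: "q * \<rho> = \<epsilon> / 2" using q_\<rho> by simp
  have 1: "1 / q \<le> \<epsilon> * m / 8" using q by (simp add: field_simps)
  have 2: "C * (\<epsilon> / 2)\<^sup>2 \<le> \<epsilon> * m / 64"
  proof -
    have "16 * (C * \<epsilon>) * \<epsilon> \<le> m * \<epsilon>" using \<epsilon>(4) \<epsilon>(1) by (intro mult_right_mono) auto
    then show ?thesis by (simp add: power2_eq_square algebra_simps)
  qed
  have 3: "\<epsilon> * m > 0" using \<epsilon> m_pos by simp
  have eq: "q * m / 2 * \<rho> = \<epsilon> * m / 4" "q * m * \<rho> = \<epsilon> * m / 2"
    using q by (simp_all add: \<rho>_def)
  have "1 / q + C * (q * \<rho>)\<^sup>2 \<le> \<epsilon> * m / 8 + \<epsilon> * m / 64"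
    unfolding q\<rho> by (rule add_mono[OF 1 2])
  with 3 show "1 / q + C * (q * \<rho>)\<^sup>2 \<le> q * m / 2 * \<rho>" "1 / q + C * (q * \<rho>)\<^sup>2 < q * m * \<rho>"
    unfolding eq by simp_all
qed

lemma newton_self_map: "norm (newton z t) \<le> \<rho>"
  if "z \<in> strip (ereal (s + 3 * d))" "norm t \<le> \<rho>"
proof -
  have "norm (remainder z t) \<le> C * (q * norm t) ^ 2"
    using that \<rho>_pos by (intro remainder_bound) auto
  also have "\<dots> \<le> C * (q * \<rho>)\<^sup>2"
    using that C_nonneg by (intro mult_left_mono power_mono) auto
  finally have "norm (of_real (q * \<theta> - p) + remainder z t) \<le> 1 / q + C * (q * \<rho>)\<^sup>2"
    using approx by (intro norm_triangle_mono) (simp_all only: norm_of_real)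
  also have "\<dots> \<le> q * m / 2 * \<rho>" by (rule small_at_\<rho>)
  finally have "norm (newton z t) \<le> (q * m / 2 * \<rho>) / (q * m / 2)"
    unfolding newton_def norm_divide norm_minus_cancel
    using drift_lower_bound[OF that(1)] q m_pos \<rho>_pos by (intro frac_le) auto
  then show ?thesis using q m_pos by simp
qed

lemma newton_contraction: "norm (newton z t - newton z t') \<le> 1 / 2 * norm (t - t')"
  if "z \<in> strip (ereal (s + 3 * d))" "norm t \<le> \<rho>" "norm t' \<le> \<rho>"
proof -
  have "newton z t - newton z t' = (remainder z t' - remainder z t) / drift z"
    by (simp add: newton_def diff_divide_distrib add_divide_distrib)
  then have "norm (newton z t - newton z t') = norm (remainder z t - remainder z t') / norm (drift z)"
    by (simp add: norm_divide norm_minus_commute)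
  also have "\<dots> \<le> (q * m / 4) * norm (t - t') / (q * m / 2)"
    using drift_lower_bound[OF that(1)] q m_pos remainder_lipschitz[OF that] by (intro frac_le) auto
  also have "\<dots> = 1 / 2 * norm (t - t')" using q m_pos by simp
  finally show ?thesis .
qed

lemma newton_holomorphic:
  assumes "T holomorphic_on strip (ereal (s + 3 * d))"
    and "\<And>z. z \<in> strip (ereal (s + 3 * d)) \<Longrightarrow> norm (T z) \<le> \<rho>"
  shows "(\<lambda>z. newton z (T z)) holomorphic_on strip (ereal (s + 3 * d))"
proof -
  have "(\<lambda>z. (G (T z) ^^ q) z) holomorphic_on strip (ereal (s + 3 * d))"
    by (rule holomorphic[where a = "\<lambda>z. z", OF open_strip holomorphic_on_ident assms(1)])
       (use assms(2) \<rho>_pos in \<open>force simp del: in_strip_iff\<close>)+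
  then show ?thesis unfolding newton_def remainder_def
    using drift_nonzero by (intro holomorphic_intros assms drift_holomorphic) auto
qed

lemma resonance_exists:
  "\<exists>T. T holomorphic_on strip (ereal (s + 3 * d)) \<and> (\<forall>z\<in>strip (ereal (s + 3 * d)). norm (T z) \<le> \<rho> \<and>
     (\<forall>t. norm t \<le> \<rho> \<longrightarrow> ((G t ^^ q) z = z + of_int p \<longleftrightarrow> t = T z)))"
proof (rule holomorphic_fixed_point[where K = newton and \<rho> = \<rho>, OF open_strip[of "s + 3 * d"]])
  show "\<rho> \<ge> 0" using \<rho>_pos by simp
  show "norm (newton w t) \<le> \<rho>" if "w \<in> strip (ereal (s + 3 * d))" "norm t \<le> \<rho>" for w t
    using that by (rule newton_self_map)
  show "norm (newton w t - newton w t') \<le> 1 / 2 * norm (t - t')"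
    if "w \<in> strip (ereal (s + 3 * d))" "norm t \<le> \<rho>" "norm t' \<le> \<rho>" for w t t'
    using that by (rule newton_contraction)
  show "(\<lambda>w. newton w (T w)) holomorphic_on strip (ereal (s + 3 * d))"
    if "T holomorphic_on strip (ereal (s + 3 * d))"
      "\<And>z. z \<in> strip (ereal (s + 3 * d)) \<Longrightarrow> norm (T z) \<le> \<rho>" for T
    using that by (rule newton_holomorphic)
  fix T assume T: "T holomorphic_on strip (ereal (s + 3 * d))"
    "\<And>w. w \<in> strip (ereal (s + 3 * d)) \<Longrightarrow> norm (T w) \<le> \<rho>"
    "\<And>w. w \<in> strip (ereal (s + 3 * d)) \<Longrightarrow> newton w (T w) = T w"
    "\<And>w t. w \<in> strip (ereal (s + 3 * d)) \<Longrightarrow> norm t \<le> \<rho> \<Longrightarrow> newton w t = t \<Longrightarrow> t = T w"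
  have "(G t ^^ q) z = z + of_int p \<longleftrightarrow> t = T z" if "z \<in> strip (ereal (s + 3 * d))" "norm t \<le> \<rho>" for z t
    using newton_fixed_iff[OF that(1), of t] T(3)[OF that(1)] T(4)[OF that] by metis
  with T(1,2) show ?thesis by (intro exI[of _ T] conjI ballI allI impI)
qed

text \<open>\<open>resonance z\<close> is the parameter for which \<open>z\<close> is periodic of type \<open>p/q\<close>.\<close>

definition resonance :: "complex \<Rightarrow> complex" where
  "resonance = (SOME T. T holomorphic_on strip (ereal (s + 3 * d)) \<and> (\<forall>z\<in>strip (ereal (s + 3 * d)). norm (T z) \<le> \<rho> \<and>
     (\<forall>t. norm t \<le> \<rho> \<longrightarrow> ((G t ^^ q) z = z + of_int p \<longleftrightarrow> t = T z))))"

lemmas resonance = someI_ex[OF resonance_exists, folded resonance_def]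

lemma resonance_holomorphic: "resonance holomorphic_on strip (ereal (s + 3 * d))"
  using resonance by (rule conjunct1)

lemma
  assumes "z \<in> strip (ereal (s + 3 * d))"
  shows resonance_bound: "norm (resonance z) \<le> \<rho>"
    and resonance_periodic: "(G (resonance z) ^^ q) z = z + of_int p"
    and resonance_eqI: "\<And>t. norm t \<le> \<rho> \<Longrightarrow> (G t ^^ q) z = z + of_int p \<Longrightarrow> resonance z = t"
proof -
  note * = resonance[THEN conjunct2, rule_format, OF assms]
  show "norm (resonance z) \<le> \<rho>" using * by blast
  then show "(G (resonance z) ^^ q) z = z + of_int p" using * by blast
  show "resonance z = t" if "norm t \<le> \<rho>" "(G t ^^ q) z = z + of_int p" for t
    using * that by (metis (no_types))
qed

lemma resonance_bound2: "norm (resonance z) \<le> 2 * \<rho>" if "z \<in> strip (ereal (s + 3 * d))"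
  using resonance_bound[OF that] \<rho>_pos by simp

lemma resonance_shift: "resonance (z + 1) = resonance z" if "z \<in> strip (ereal (s + 3 * d))"
proof (rule resonance_eqI)
  show "(G (resonance z) ^^ q) (z + 1) = z + 1 + of_int p"
    using shift[OF that resonance_bound2[OF that], of q] resonance_periodic[OF that] by simp
qed (use that resonance_bound[OF that] in auto)

section \<open>The map at its resonant parameter and its linearisation\<close>

definition advance :: "complex \<Rightarrow> complex" where
  "advance z = G (resonance z) z"

lemma advance_in_strip: "advance z \<in> strip (ereal (s + 3 * d))" if z: "z \<in> strip (ereal (s + 2 * d))"
proof -
  have z3: "z \<in> strip (ereal (s + 3 * d))" using z d by auto
  have "norm (A (z + of_real \<theta>) (resonance z) - (z + of_real \<theta>)) \<le> speed * norm (resonance z)"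
    using strip_mono[OF z3] resonance_bound2[OF z3] radius by (intro A_displacement) auto
  also have "\<dots> \<le> speed * \<epsilon>"
    using resonance_bound2[OF z3] \<rho>_le speed_nonneg by (intro mult_left_mono) auto
  also have "\<dots> \<le> d" using \<epsilon>(3) mult_nonneg_nonneg[OF speed_nonneg less_imp_le[OF \<epsilon>(1)]] by linarith
  finally show ?thesis
    using z unfolding advance_def G_def
    by (intro strip_near[of "z + of_real \<theta>" "s + 2 * d" _ "s + 3 * d"]) (simp_all only: in_strip_iff, simp_all)
qed

text \<open>If z is periodic of type p/q at parameter t, then so is its image; uniqueness of the
  small parameter makes both values agree.\<close>

lemma resonance_advance: "resonance (advance z) = resonance z" if z: "z \<in> strip (ereal (s + 2 * d))"
proof (rule resonance_eqI[OF advance_in_strip[OF z]])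
  have z3: "z \<in> strip (ereal (s + 3 * d))" using z d by auto
  show "norm (resonance z) \<le> \<rho>" by (rule resonance_bound[OF z3])
  have "(G (resonance z) ^^ q) (advance z) = G (resonance z) ((G (resonance z) ^^ q) z)"
    by (simp add: advance_def funpow_swap1)
  also have "\<dots> = A (z + of_real \<theta> + of_int p) (resonance z)"
    by (simp add: resonance_periodic[OF z3] G_def add_ac)
  also have "\<dots> = A (z + of_real \<theta>) (resonance z) + of_int p"
  proof -
    have "A (w + 1) (resonance z) = A w (resonance z) + 1" if "w \<in> strip (ereal \<sigma>)" for w
      using that resonance_bound2[OF z3] radius by (intro A_shift) auto
    from periodic_int_shift[of \<sigma> "\<lambda>w. A w (resonance z)" 1 "z + of_real \<theta>" p, OF this]
    show ?thesis using strip_mono[OF z3] by simp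
  qed
  finally show "(G (resonance z) ^^ q) (advance z) = advance z + of_int p"
    by (simp add: advance_def G_def)
qed

text \<open>Averaging over the periodic orbit linearises \<^term>\<open>advance\<close>.\<close>

definition linearizer :: "complex \<Rightarrow> complex" where
  "linearizer z = (\<Sum>k<q. (G (resonance z) ^^ k) z - of_real (k * (p / q))) / of_nat q"

definition correction :: "complex \<Rightarrow> complex" where
  "correction z = linearizer z - z"

lemma linearizer_holomorphic: "linearizer holomorphic_on strip (ereal (s + 3 * d))"
proof -
  have "(\<lambda>z. (G (resonance z) ^^ k) z) holomorphic_on strip (ereal (s + 3 * d))" if "k < q" for k
    by (rule holomorphic[where a = "\<lambda>z. z", OF open_strip holomorphic_on_ident resonance_holomorphic _ resonance_bound2])
       (use that in auto)
  then show ?thesis unfolding linearizer_def[abs_def] using q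
    by (intro holomorphic_intros) auto
qed

text \<open>Two errors of at most d/16 each: the distance of the orbit from the rotation orbit, and
  the replacement of k \<theta> by k p/q, which costs at most |q \<theta> - p|.\<close>

lemma correction_bound: "norm (correction z) \<le> d / 8" if z: "z \<in> strip (ereal (s + 3 * d))"
proof -
  have "norm ((G (resonance z) ^^ k) z - of_real (k * (p / q)) - z) \<le> d / 8" if "k < q" for k
  proof -
    have "norm ((G (resonance z) ^^ k) z - z - of_nat k * of_real \<theta>) \<le> k * (speed * norm (resonance z))"
      using displacement[OF z resonance_bound2[OF z], of k] that by simp
    also have "\<dots> \<le> q * (speed * (2 * \<rho>))"
      using that resonance_bound2[OF z] speed_nonneg \<rho>_pos by (intro mult_mono mult_left_mono) auto
    also have "\<dots> = speed * \<epsilon>" using q_\<rho> by (simp add: mult.left_commute)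
    also have "\<dots> \<le> d / 16" using \<epsilon>(3) by simp
    finally have 1: "norm ((G (resonance z) ^^ k) z - z - of_nat k * of_real \<theta>) \<le> d / 16" .
    have "\<bar>k * \<theta> - k * (p / q)\<bar> = k / q * \<bar>q * \<theta> - p\<bar>"
    proof -
      have "k * \<theta> - k * (p / q) = k / q * (q * \<theta> - p)" using q by (simp add: field_simps)
      then show ?thesis by (simp add: abs_mult)
    qed
    also have "\<dots> \<le> 1 * (1 / q)" using that approx by (intro mult_mono) auto
    also have "\<dots> \<le> d / 16" using q by (simp add: field_simps)
    finally have 2: "norm (of_real (k * \<theta> - k * (p / q)) :: complex) \<le> d / 16"
      by (simp only: norm_of_real)
    have "(G (resonance z) ^^ k) z - of_real (k * (p / q)) - z =
       ((G (resonance z) ^^ k) z - z - of_nat k * of_real \<theta>) + of_real (k * \<theta> - k * (p / q))"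
      by simp
    also have "norm \<dots> \<le> d / 16 + d / 16" by (intro norm_triangle_mono 1 2)
    finally show ?thesis by simp
  qed
  then have "norm (\<Sum>k<q. (G (resonance z) ^^ k) z - of_real (k * (p / q)) - z) \<le> (\<Sum>k<q. d / 8)"
    by (intro sum_norm_le) auto
  moreover have "correction z = (\<Sum>k<q. (G (resonance z) ^^ k) z - of_real (k * (p / q)) - z) / of_nat q"
    using q by (simp add: correction_def linearizer_def sum_subtractf diff_divide_distrib)
  ultimately show ?thesis using q by (simp add: norm_divide divide_le_eq mult.commute)
qed

lemma linearizer_shift: "linearizer (z + 1) = linearizer z + 1" if z: "z \<in> strip (ereal (s + 3 * d))"
proof -
  have "(\<Sum>k<q. (G (resonance (z + 1)) ^^ k) (z + 1) - of_real (k * (p / q)))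
     = (\<Sum>k<q. ((G (resonance z) ^^ k) z - of_real (k * (p / q))) + 1)"
    by (intro sum.cong refl) (simp add: resonance_shift[OF z] shift[OF z resonance_bound2[OF z]])
  then show ?thesis using q unfolding linearizer_def sum.distrib by (simp add: add_divide_distrib)
qed

text \<open>The orbit sum is shifted by one index and telescopes to its end terms, which cancel
  because the orbit closes up after q steps to the translation by p.\<close>

lemma linearizer_advance: "linearizer (advance z) = linearizer z + of_real (p / q)"
  if z: "z \<in> strip (ereal (s + 2 * d))"
proof -
  have z3: "z \<in> strip (ereal (s + 3 * d))" using z d by auto
  let ?g = "\<lambda>k. (G (resonance z) ^^ k) z - of_real (k * (p / q))"
  have "(\<Sum>k<q. (G (resonance (advance z)) ^^ k) (advance z) - of_real (k * (p / q)))
     = (\<Sum>k<q. ?g (Suc k) + of_real (p / q))"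
    unfolding resonance_advance[OF z]
    by (intro sum.cong refl) (simp add: advance_def funpow_swap1 add_divide_distrib distrib_right)
  also have "\<dots> = (\<Sum>k<q. ?g (Suc k) - ?g k) + (\<Sum>k<q. ?g k) + of_nat q * of_real (p / q)"
    by (simp only: sum.distrib sum_subtractf) simp
  also have "(\<Sum>k<q. ?g (Suc k) - ?g k) = ?g q - ?g 0" by (rule sum_lessThan_telescope)
  also have "\<dots> = 0" using q by (simp add: resonance_periodic[OF z3])
  finally show ?thesis using q unfolding linearizer_def by (simp add: add_divide_distrib)
qed

lemma correction_lipschitz: "norm (correction z - correction w) \<le> 1 / 8 * norm (z - w)"
  if "z \<in> strip (ereal (s + 2 * d))" "w \<in> strip (ereal (s + 2 * d))"
proof -
  have eq: "s + 2 * d + d = s + 3 * d" by simp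
  have "norm (correction z - correction w) \<le> (d / 8) / d * norm (z - w)"
  proof (rule lipschitz_on_strip[OF _ d _ that])
    show "correction holomorphic_on strip (ereal (s + 2 * d + d))"
      unfolding correction_def[abs_def] eq by (intro holomorphic_intros linearizer_holomorphic)
    show "norm (correction z) \<le> d / 8" if "z \<in> strip (ereal (s + 2 * d + d))" for z
      using correction_bound that unfolding eq .
  qed
  then show ?thesis using d by simp
qed

text \<open>The inverse is sought as \<open>w + V w\<close>, where \<open>V w\<close> is the fixed
  point of the contraction that sends v to \<open>- correction (w + v)\<close>. Its uniqueness makes
  this right inverse a left inverse as well.\<close>

lemma linearizer_inverse_exists:
  obtains V where "V holomorphic_on strip (ereal (s + d))"
    "\<And>w. w \<in> strip (ereal (s + d)) \<Longrightarrow> norm (V w) \<le> d / 2"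
    "\<And>w. w \<in> strip (ereal (s + d)) \<Longrightarrow> linearizer (w + V w) = w"
    "\<And>w v. w \<in> strip (ereal (s + d)) \<Longrightarrow> norm v \<le> d / 2 \<Longrightarrow> linearizer (w + v) = w \<Longrightarrow> v = V w"
proof -
  have in2: "w + v \<in> strip (ereal (s + 2 * d))" if "w \<in> strip (ereal (s + d))" "norm v \<le> d / 2" for w v
    by (rule strip_near[OF that(1)]) (use that(2) d in simp)
  have in3: "z \<in> strip (ereal (s + 3 * d))" if "z \<in> strip (ereal (s + 2 * d))" for z
    using that d by auto
  show thesis
  proof (rule holomorphic_fixed_point[where K = "\<lambda>w v. - correction (w + v)" and \<rho> = "d / 2", OF open_strip[of "s + d"]])
    show "d / 2 \<ge> 0" using d by simp
    show "norm (- correction (w + v)) \<le> d / 2" if "w \<in> strip (ereal (s + d))" "norm v \<le> d / 2" for w v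
      using correction_bound[OF in3[OF in2[OF that]]] d by simp
    show "norm (- correction (w + v) - - correction (w + v')) \<le> 1 / 2 * norm (v - v')"
      if "w \<in> strip (ereal (s + d))" "norm v \<le> d / 2" "norm v' \<le> d / 2" for w v v'
    proof -
      have "norm (- correction (w + v) - - correction (w + v')) = norm (correction (w + v) - correction (w + v'))"
        by (simp add: norm_minus_commute)
      also have "\<dots> \<le> 1 / 8 * norm ((w + v) - (w + v'))"
        by (rule correction_lipschitz[OF in2[OF that(1,2)] in2[OF that(1,3)]])
      also have "\<dots> \<le> 1 / 2 * norm (v - v')" by simp
      finally show ?thesis .
    qed
    show "(\<lambda>w. - correction (w + T w)) holomorphic_on strip (ereal (s + d))"
      if "T holomorphic_on strip (ereal (s + d))" "\<And>w. w \<in> strip (ereal (s + d)) \<Longrightarrow> norm (T w) \<le> d / 2" for T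
      unfolding correction_def
      by (intro holomorphic_intros that holomorphic_on_compose_gen[OF _ linearizer_holomorphic, unfolded comp_def])
         (use in2 in3 that(2) in blast)
    fix T assume T: "T holomorphic_on strip (ereal (s + d))"
      "\<And>w. w \<in> strip (ereal (s + d)) \<Longrightarrow> norm (T w) \<le> d / 2"
      "\<And>w. w \<in> strip (ereal (s + d)) \<Longrightarrow> - correction (w + T w) = T w"
      "\<And>w t. w \<in> strip (ereal (s + d)) \<Longrightarrow> norm t \<le> d / 2 \<Longrightarrow> - correction (w + t) = t \<Longrightarrow> t = T w"
    have iff: "- correction (w + v) = v \<longleftrightarrow> linearizer (w + v) = w" for w v
      by (auto simp: correction_def algebra_simps)
    show thesis by (rule that[of T]) (use T iff in blast)+
  qed
qed

text \<open>Here \<open>u\<close> is \<open>resonance\<close> read in the linearised coordinate,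
  bounded by \<rho>; \<open>resonance_shift\<close> gives it the period 1 and
  \<open>resonance_advance\<close> the period p/q.\<close>

lemma resonance_oscillation:
  obtains u where "\<And>x::real. u (linearizer x) = resonance x"
    "\<And>(x::real) (y::real). norm (u x - u y) \<le> 4 * (\<rho> / (exp (2 * pi * s * q) - 1))"
proof (rule linearizer_inverse_exists)
  fix V assume V: "V holomorphic_on strip (ereal (s + d))"
    "\<And>w. w \<in> strip (ereal (s + d)) \<Longrightarrow> norm (V w) \<le> d / 2"
    "\<And>w. w \<in> strip (ereal (s + d)) \<Longrightarrow> linearizer (w + V w) = w"
    "\<And>w v. w \<in> strip (ereal (s + d)) \<Longrightarrow> norm v \<le> d / 2 \<Longrightarrow> linearizer (w + v) = w \<Longrightarrow> v = V w"
  define Z where "Z w = w + V w" for w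
  have Z2: "Z w \<in> strip (ereal (s + 2 * d))" if "w \<in> strip (ereal (s + d))" for w
    by (rule strip_near[OF that]) (use V(2)[OF that] d in \<open>simp add: Z_def\<close>)
  then have Z3: "Z w \<in> strip (ereal (s + 3 * d))" if "w \<in> strip (ereal (s + d))" for w
    using d that by force
  have ZI: "z = Z (linearizer z)"
    if "z \<in> strip (ereal (s + 3 * d))" "linearizer z \<in> strip (ereal (s + d))" for z
  proof -
    have "z - linearizer z = V (linearizer z)"
      using correction_bound[OF that(1)] d
      by (intro V(4)[OF that(2)]) (simp_all add: correction_def norm_minus_commute)
    then show ?thesis unfolding Z_def by (metis add.commute diff_add_cancel)
  qed
  define u where "u w = resonance (Z w)" for w
  have u_hol: "u holomorphic_on strip (ereal (s + d))"
    unfolding u_def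
    by (rule holomorphic_on_compose_gen[OF _ resonance_holomorphic, unfolded comp_def])
       (use V(1) Z3 in \<open>auto simp: Z_def[abs_def] intro!: holomorphic_intros simp del: in_strip_iff\<close>)
  have u1: "u (w + of_real 1) = u w + 0" if "w \<in> strip (ereal (s + d))" for w
  proof -
    have "linearizer (Z w + 1) = w + 1" using linearizer_shift[OF Z3[OF that]] V(3)[OF that] by (simp add: Z_def)
    then have "Z w + 1 = Z (w + 1)" using ZI[of "Z w + 1"] Z3[OF that] that by simp
    then show ?thesis using resonance_shift[OF Z3[OF that]] by (simp add: u_def)
  qed
  have up: "u (w + of_real (p / q)) = u w + 0" if "w \<in> strip (ereal (s + d))" for w
  proof -
    have eq: "linearizer (advance (Z w)) = w + of_real (p / q)"
      using linearizer_advance[OF Z2[OF that]] V(3)[OF that] by (simp add: Z_def)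
    have "advance (Z w) = Z (linearizer (advance (Z w)))"
      by (rule ZI[OF advance_in_strip[OF Z2[OF that]]]) (use that in \<open>simp add: eq\<close>)
    then show ?thesis using resonance_advance[OF Z2[OF that]] unfolding eq u_def by simp
  qed
  \<comment> \<open>Bezout turns the two periods into one: a (p/q) + b = 1/q.\<close>
  obtain a b :: int where ab: "a * p + b * int q = 1"
    using cop bezout_int[of p "int q"] by (auto simp: coprime_iff_gcd_eq_1)
  have uq: "u (w + of_real (1 / q)) = u w" if "w \<in> strip (ereal (s + d))" for w
  proof -
    have "real_of_int (a * p + b * int q) = 1" by (simp only: ab of_int_1)
    then have "1 / q = a * (p / q) + b" using q by (simp add: field_simps)
    then have eq: "w + of_real (1 / q) = (w + of_int a * of_real (p / q)) + of_int b * of_real 1"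
      by (metis (no_types) add.assoc mult_1_right of_real_1 of_real_add of_real_mult of_real_of_int_eq)
    have "u (w + of_real (1 / q)) = u (w + of_int a * of_real (p / q)) + of_int b * 0"
      unfolding eq by (rule shift_int_multiple[where f = u, OF u1]) (use that in auto)
    also have "u (w + of_int a * of_real (p / q)) = u w + of_int a * 0"
      by (rule shift_int_multiple[where f = u, OF up that])
    finally show ?thesis by simp
  qed
  show thesis
  proof (rule that[of u])
    show "u (linearizer x) = resonance x" for x :: real
    proof -
      have x: "complex_of_real x \<in> strip (ereal (s + 3 * d))" using s d by simp
      have "linearizer x \<in> strip (ereal (s + d))"
        using correction_bound[OF x] s d abs_Im_le_cmod[of "correction x"] by (simp add: correction_def)
      then show ?thesis using ZI[OF x] by (simp add: u_def)
    qed
    show "norm (u x - u y) \<le> 4 * (\<rho> / (exp (2 * pi * s * q) - 1))" for x y :: real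
      using s d q by (intro periodic_strip_oscillation[OF u_hol _ _ _ uq])
        (auto simp: u_def simp del: in_strip_iff intro: resonance_bound Z3)
  qed
qed

section \<open>Consequences for real parameters\<close>

text \<open>A real orbit makes \<open>linearizer\<close> real at its base point, and it is on the
  real line that the oscillation of \<open>u\<close> is bounded. Reality is a hypothesis because
  \<open>A\<close> is not assumed to preserve the real line.\<close>

lemma resonant_parameters_close:
  fixes x x' t t' :: real
  assumes "\<bar>t\<bar> \<le> \<rho>" "\<bar>t'\<bar> \<le> \<rho>"
    and "(G (of_real t) ^^ q) (of_real x) = of_real x + of_int p" "(G (of_real t') ^^ q) (of_real x') = of_real x' + of_int p"
    and "\<And>k. (G (of_real t) ^^ k) (of_real x) \<in> \<real>" "\<And>k. (G (of_real t') ^^ k) (of_real x') \<in> \<real>"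
  shows "\<bar>t - t'\<bar> \<le> 4 * (\<rho> / (exp (2 * pi * s * q) - 1))"
proof (rule resonance_oscillation)
  fix u assume u: "\<And>x::real. u (linearizer x) = resonance x"
    "\<And>(x::real) (y::real). norm (u x - u y) \<le> 4 * (\<rho> / (exp (2 * pi * s * q) - 1))"
  have *: "\<exists>y::real. of_real t = u y"
    if t: "\<bar>t\<bar> \<le> \<rho>" "(G (of_real t) ^^ q) (of_real x) = of_real x + of_int p" "\<And>k. (G (of_real t) ^^ k) (of_real x) \<in> \<real>" for t x :: real
  proof -
    have "complex_of_real x \<in> strip (ereal (s + 3 * d))" using s d by simp
    from resonance_eqI[OF this, of "of_real t"] t have r: "resonance x = of_real t" by simp
    have "linearizer x \<in> \<real>" unfolding linearizer_def r
      by (intro Reals_divide sum_in_Reals Reals_diff t(3)) auto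
    then obtain y where "linearizer x = complex_of_real y" by (auto elim: Reals_cases)
    with u(1)[of x] r show ?thesis by metis
  qed
  obtain y y' :: real where y: "complex_of_real t = u y" "complex_of_real t' = u y'"
    using *[OF assms(1,3,5)] *[OF assms(2,4,6)] by blast
  have "\<bar>t - t'\<bar> = norm (of_real t - of_real t' :: complex)" by (metis norm_of_real of_real_diff)
  with u(2)[of y y'] show ?thesis by (simp add: y)
qed

text \<open>On the real line the linear term has a definite sign and dominates at t =
  \<plusminus>\<rho>. By monotonicity in t this later confines all locked parameters to the interval
  from -\<rho> to \<rho>.\<close>

lemma
  fixes x :: real
  shows above_resonance: "Re ((G (of_real \<rho>) ^^ q) (of_real x)) > x + p"
    and below_resonance: "Re ((G (of_real (- \<rho>)) ^^ q) (of_real x)) < x + p"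
proof -
  have x: "complex_of_real x \<in> strip (ereal (s + 3 * d))" using s d by simp
  have "q * m = (\<Sum>k=1..q. m)" by simp
  also have "\<dots> \<le> (\<Sum>k=1..q. Re (f (x + of_nat k * of_real \<theta>)))"
  proof (rule sum_mono)
    fix k show "m \<le> Re (f (x + of_nat k * of_real \<theta>))" using f_real[of "x + k * \<theta>"] by simp
  qed
  finally have D: "q * m \<le> Re (drift x)" by (simp add: drift_def)
  have b: "\<bar>Re (remainder x t)\<bar> \<le> C * (q * \<rho>)\<^sup>2" if "norm t = \<rho>" for t
    using remainder_bound[OF x, of t] that \<rho>_pos abs_Re_le_cmod[of "remainder x t"] by simp
  have D\<rho>: "q * m * \<rho> \<le> Re (drift x) * \<rho>" using D \<rho>_pos by (intro mult_right_mono) auto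
  have "Re ((G t ^^ q) (of_real x)) = x + q * \<theta> + Re (t * drift x) + Re (remainder x t)" for t
    by (simp add: remainder_def)
  from this[of "of_real \<rho>"] this[of "of_real (- \<rho>)"]
  have eq: "Re ((G (of_real \<rho>) ^^ q) (of_real x)) = x + q * \<theta> + Re (drift x) * \<rho> + Re (remainder x (of_real \<rho>))"
    "Re ((G (of_real (- \<rho>)) ^^ q) (of_real x)) = x + q * \<theta> - Re (drift x) * \<rho> + Re (remainder x (of_real (- \<rho>)))"
    by simp_all
  have n: "norm (complex_of_real \<rho>) = \<rho>" "norm (complex_of_real (- \<rho>)) = \<rho>" using \<rho>_pos by simp_all
  show "Re ((G (of_real \<rho>) ^^ q) (of_real x)) > x + p" "Re ((G (of_real (- \<rho>)) ^^ q) (of_real x)) < x + p"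
    using eq b[OF n(1)] b[OF n(2)] small_at_\<rho>(2) approx D\<rho> by linarith+
qed

end

section \<open>The linearising coordinate on the Herman strip\<close>

text \<open>Taylor's formula of first order; Cauchy's estimate on discs of radius e/2 bounds the
  second derivative by 2 B / (e/2)^2 = 8 B / e^2.\<close>

lemma quadratic_expansion_on_ball:
  assumes hol: "\<Phi> holomorphic_on U" and U: "open U" and e: "e > 0" and sub: "cball w e \<subseteq> U"
    and B: "\<And>y. y \<in> cball w e \<Longrightarrow> norm (\<Phi> y) \<le> B" and t: "norm t \<le> e / 2"
  shows "norm (\<Phi> (w + t) - \<Phi> w - deriv \<Phi> w * t) \<le> 8 * B / e\<^sup>2 * norm t ^ 2"
proof -
  let ?f = "\<lambda>i. (deriv ^^ i) \<Phi>"
  have in_U: "x \<in> U" if "x \<in> cball w (e / 2)" for x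
    using that sub e by auto
  have "norm (?f 0 (w + t) - (\<Sum>i\<le>1. ?f i w * ((w + t) - w) ^ i / fact i))
      \<le> 8 * B / e\<^sup>2 * norm ((w + t) - w) ^ Suc 1 / fact 1"
  proof (rule complex_Taylor[where S = "cball w (e / 2)"])
    fix i x assume "x \<in> cball w (e / 2)"
    then have "(?f i has_field_derivative deriv (?f i) x) (at x)"
      by (intro holomorphic_derivI[OF holomorphic_higher_deriv[OF hol U] U] in_U)
    then show "(?f i has_field_derivative ?f (Suc i) x) (at x within cball w (e / 2))"
      by (simp add: has_field_derivative_at_within)
  next
    fix x assume x: "x \<in> cball w (e / 2)"
    have near: "y \<in> cball w e" if "dist x y \<le> e / 2" for y
      using dist_triangle[of w y x] x that by simp
    have "norm (?f 2 x) \<le> fact 2 * B / (e / 2) ^ 2"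
    proof (rule Cauchy_inequality)
      have "cball x (e / 2) \<subseteq> U" using near sub by auto
      then show "\<Phi> holomorphic_on ball x (e / 2)" "continuous_on (cball x (e / 2)) \<Phi>"
        using ball_subset_cball
        by (blast intro: holomorphic_on_subset[OF hol] holomorphic_on_imp_continuous_on)+
      show "norm (\<Phi> y) \<le> B" if "norm (x - y) = e / 2" for y
        using that by (intro B near) (simp add: dist_norm)
    qed (use e in auto)
    then show "norm (?f (Suc 1) x) \<le> 8 * B / e\<^sup>2"
      by (simp add: power_divide numeral_2_eq_2)
  qed (use e t in \<open>auto simp: dist_norm\<close>)
  then show ?thesis by (simp add: power2_eq_square algebra_simps)
qed

lemma (in circle_map) continuous_if_surj: "continuous_on UNIV F" if "surj F"
  using that by (intro continuous_onI_mono) (auto dest: monoD[OF mono])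

lemma (in circle_map) circle_map_translate: "circle_map (\<lambda>x. F x + t)"
  by unfold_locales (auto intro!: monoI dest: monoD[OF mono] simp: shift)

lemma funpow_le_funpow:
  fixes f g :: "'a::order \<Rightarrow> 'a"
  assumes "\<And>x. f x \<le> g x" "mono g"
  shows "(f ^^ n) x \<le> (g ^^ n) x"
proof (induction n)
  case (Suc n)
  have "f ((f ^^ n) x) \<le> g ((f ^^ n) x)" by (rule assms(1))
  also have "\<dots> \<le> g ((g ^^ n) x)" by (rule monoD[OF assms(2) Suc])
  finally show ?case by simp
qed simp

lemma measure_lborel_le_of_diameter:
  fixes S :: "real set"
  assumes "\<And>x y. x \<in> S \<Longrightarrow> y \<in> S \<Longrightarrow> \<bar>x - y\<bar> \<le> D" "D \<ge> 0"
  shows "measure lborel S \<le> 2 * D"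
\<comment> \<open>The value of \<open>measure\<close> on a non-measurable set is 0.\<close>
proof (cases "S = {} \<or> S \<notin> sets lborel")
  case True
  then show ?thesis using assms(2) by (auto simp: measure_notin_sets)
next
  case False
  then obtain a where a: "a \<in> S" by auto
  have "S \<subseteq> {a - D..a + D}" using assms(1)[OF a] by (fastforce simp: abs_le_iff)
  then have "measure lborel S \<le> measure lborel {a - D..a + D}"
    using False by (intro measure_mono_fmeasurable) (auto simp: fmeasurable_def)
  then show ?thesis using assms(2) by simp
qed

locale herman_strip = circle_map F for F +
  fixes \<theta> b :: real and g :: "complex \<Rightarrow> complex"
  assumes surj_F: "surj F" and trans_F: "trans_num F = \<theta>" and bij_lin: "bij (lin_map F)"
    and g_hol: "g holomorphic_on strip (ereal b)" and g_inj: "inj_on g (strip (ereal b))"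
    and g_real: "\<And>x::real. g (of_real x) = of_real (inv (lin_map F) x)" and b_pos: "b > 0"
begin

abbreviation h :: "real \<Rightarrow> real" where "h \<equiv> lin_map F"

lemmas h_shift = lin_map_shift[OF trans_F bij_lin]
  and h_conj = lin_map_conj[OF trans_F bij_lin]
  and h_mono = lin_map_strict_mono[OF trans_F bij_lin]

lemma g_h: "g (of_real (h x)) = of_real x"
  using bij_lin by (simp add: g_real bij_is_inj)

lemma h_shift_int: "h (x + of_int k) = h x + of_int k"
proof (induction k rule: int_induct[where k = 0])
  case (step1 i)
  then show ?case using h_shift[of "x + of_int i"] by (simp add: algebra_simps)
next
  case (step2 i)
  then show ?case using h_shift[of "x + of_int (i - 1)"] by (simp add: algebra_simps)
qed simp

text \<open>On the real line \<open>g\<close> is the inverse of \<open>h\<close>, which commutes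
  with the unit translation; the identity theorem carries this to the strip.\<close>

lemma g_shift: "g (z + 1) = g z + 1" if z: "z \<in> strip (ereal b)"
proof -
  have "g (z + 1) - g z - 1 = 0"
  proof (rule analytic_continuation[where f = "\<lambda>z. g (z + 1) - g z - 1" and U = \<real> and \<xi> = 0, OF _ open_strip _ _ _ _ _ z])
    have "(\<lambda>z. g (z + 1)) holomorphic_on strip (ereal b)"
      by (rule holomorphic_on_compose_gen[OF _ g_hol, unfolded comp_def]) (auto intro!: holomorphic_intros)
    then show "(\<lambda>z. g (z + 1) - g z - 1) holomorphic_on strip (ereal b)"
      by (intro holomorphic_intros g_hol)
    show "(0::complex) islimpt \<real>"
    proof (unfold islimpt_approachable, intro allI impI)
      fix e :: real assume "e > 0"
      then show "\<exists>x'\<in>\<real>. x' \<noteq> (0::complex) \<and> dist x' 0 < e"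
        by (intro bexI[of _ "of_real (e / 2)"]) auto
    qed
    fix y :: complex assume "y \<in> \<real>"
    then obtain x where x: "y = of_real x" by (auto elim: Reals_cases)
    obtain w where w: "x = h w" using bij_lin by (metis bij_pointE)
    have "g (of_real (h w) + 1) = g (of_real (h (w + 1)))" by (simp add: h_shift)
    then show "g (y + 1) - g y - 1 = 0" unfolding x w by (simp only: g_h) simp
  qed (use b_pos in \<open>auto elim!: Reals_cases intro: convex_connected convex_strip\<close>)
  then show ?thesis by (simp add: algebra_simps)
qed

lemma deriv_g_nonzero: "deriv g z \<noteq> 0" if "z \<in> strip (ereal b)"
  by (rule holomorphic_injective_imp_regular[OF g_hol open_strip g_inj that])

lemma deriv_g_shift: "deriv g (z + 1) = deriv g z" if z: "z \<in> strip (ereal b)"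
proof -
  have "(g has_field_derivative deriv g (z + 1)) (at (z + 1))"
    using z by (intro holomorphic_derivI[OF g_hol open_strip]) auto
  then have 1: "((\<lambda>z. g (z + 1)) has_field_derivative deriv g (z + 1)) (at z)"
    by (simp only: DERIV_shift)
  have "((\<lambda>z. g z + 1) has_field_derivative deriv g z) (at z)"
    using holomorphic_derivI[OF g_hol open_strip z] by (auto intro!: derivative_eq_intros)
  then have "((\<lambda>z. g (z + 1)) has_field_derivative deriv g z) (at z)"
    by (rule has_field_derivative_transform_within_open[OF _ open_strip z]) (simp add: g_shift)
  with 1 show ?thesis by (rule DERIV_unique)
qed

text \<open>A limit of difference quotients along real points, nonnegative because \<open>h\<close>
  is increasing. With \<open>deriv_g_nonzero\<close> this makes \<open>f\<close> positive on the
  real line.\<close>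

lemma deriv_g_real: "deriv g (of_real x) \<in> \<real>\<^sub>\<ge>\<^sub>0"
proof -
  have "of_real x \<in> strip (ereal b)" using b_pos by simp
  from holomorphic_derivI[OF g_hol open_strip this]
  have D: "((\<lambda>y. (g y - g (of_real x)) / (y - of_real x)) \<longlongrightarrow> deriv g (of_real x)) (at (of_real x))"
    by (simp add: has_field_derivative_iff)
  define y :: "nat \<Rightarrow> real" where "y n = x + 1 / Suc n" for n
  have "filterlim (\<lambda>n. complex_of_real (y n)) (at (of_real x)) sequentially"
  proof (rule filterlim_atI)
    have "y \<longlonglongrightarrow> x + 0" unfolding y_def
      by (rule tendsto_add[OF tendsto_const LIMSEQ_Suc[OF lim_1_over_n]])
    then show "(\<lambda>n. complex_of_real (y n)) \<longlonglongrightarrow> of_real x" by (intro tendsto_of_real) simp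
    have "y n \<noteq> x" for n by (simp add: y_def)
    then show "\<forall>\<^sub>F n in sequentially. complex_of_real (y n) \<noteq> of_real x" by simp
  qed
  from filterlim_compose[OF D this]
  have "(\<lambda>n. (g (y n) - g (of_real x)) / (of_real (y n) - of_real x)) \<longlonglongrightarrow> deriv g (of_real x)" .
  moreover have "(g (y n) - g (of_real x)) / (of_real (y n) - of_real x) \<in> \<real>\<^sub>\<ge>\<^sub>0" for n
  proof -
    obtain v w where vw: "x = h v" "y n = h w" using bij_lin by (metis bij_pointE)
    have "h v < h w" unfolding vw[symmetric] by (simp add: y_def)
    then have "v \<le> w" "h v \<le> h w" using strict_mono_less[OF h_mono, of v w] by simp_all
    then have "(w - v) / (h w - h v) \<ge> 0" by simp
    then have "complex_of_real ((w - v) / (h w - h v)) \<in> \<real>\<^sub>\<ge>\<^sub>0" by (simp only: nonneg_Reals_of_real_iff)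
    then show ?thesis unfolding vw g_h by simp
  qed
  ultimately show ?thesis
    by (intro Lim_in_closed_set[OF closed_nonneg_Reals_complex _ sequentially_bot]) auto
qed

text \<open>The velocity at t = 0 of the translated family in the linearising coordinate, as
  \<open>deriv_\<Phi>\<close> shows.\<close>

definition f :: "complex \<Rightarrow> complex" where "f z = inverse (deriv g z)"

lemma f_hol: "f holomorphic_on strip (ereal b)"
  unfolding f_def[abs_def]
  by (intro holomorphic_intros holomorphic_deriv g_hol open_strip) (auto simp: deriv_g_nonzero simp del: in_strip_iff)

lemma f_shift: "f (z + 1) = f z" if "z \<in> strip (ereal b)"
  by (simp add: f_def deriv_g_shift[OF that])

lemma f_real_lower_bound:
  obtains m where "m > 0" "\<And>x::real. Re (f (of_real x)) \<ge> m"
proof -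
  have pos: "Re (f (of_real x)) > 0" for x
  proof -
    from deriv_g_real[of x] obtain r where r: "deriv g (of_real x) = of_real r" "r \<ge> 0"
      by (auto elim: nonneg_Reals_cases)
    moreover have "r \<noteq> 0" using deriv_g_nonzero[of "of_real x"] b_pos r by auto
    ultimately show ?thesis by (simp add: f_def)
  qed
  have "continuous_on {0..1} (\<lambda>x. f (complex_of_real x))"
    by (rule continuous_on_compose2[OF holomorphic_on_imp_continuous_on[OF f_hol]])
       (use b_pos in \<open>auto intro!: continuous_intros\<close>)
  then have "\<exists>y\<in>{0..1}. \<forall>x\<in>{0..1}. Re (f (of_real y)) \<le> Re (f (complex_of_real x))"
    by (intro continuous_attains_inf continuous_intros) auto
  then obtain y where y: "\<And>x. x \<in> {0..1} \<Longrightarrow> Re (f (of_real y)) \<le> Re (f (complex_of_real x))" by blast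
  show ?thesis
  proof (rule that[OF pos[of y]])
    fix x
    have "f (of_real (frac x) + of_int \<lfloor>x\<rfloor>) = f (of_real (frac x)) + of_int \<lfloor>x\<rfloor> * 0"
      by (rule periodic_int_shift[where b = b]) (use b_pos f_shift in auto)
    moreover have "complex_of_real (frac x) + of_int \<lfloor>x\<rfloor> = of_real x" by (simp add: frac_def)
    ultimately have "f (of_real x) = f (of_real (frac x))" by simp
    then show "Re (f (of_real y)) \<le> Re (f (of_real x))"
      using y[of "frac x"] by (simp add: frac_lt_1 less_imp_le)
  qed
qed

definition \<Phi> :: "complex \<Rightarrow> complex" where "\<Phi> = the_inv_into (strip (ereal b)) g"

lemma \<Phi>_g: "\<Phi> (g z) = z" if "z \<in> strip (ereal b)"
  unfolding \<Phi>_def by (rule the_inv_into_f_f[OF g_inj that])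

lemma \<Phi>_hol: "\<Phi> holomorphic_on g ` strip (ereal b)"
proof (rule holomorphic_has_inverse[OF g_hol open_strip g_inj])
  fix \<phi> assume "\<phi> holomorphic_on g ` strip (ereal b)" and *: "\<And>z. z \<in> strip (ereal b) \<Longrightarrow> \<phi> (g z) = z"
  then show ?thesis by (rule_tac holomorphic_transform[of \<phi>]) (auto simp: \<Phi>_g simp del: in_strip_iff)
qed

lemma open_image: "open (g ` strip (ereal b))"
  by (rule open_mapping_thm3[OF g_hol open_strip g_inj])

lemma deriv_\<Phi>: "deriv \<Phi> (g z) = f z" if z: "z \<in> strip (ereal b)"
proof -
  have "((\<lambda>z. \<Phi> (g z)) has_field_derivative deriv \<Phi> (g z) * deriv g z) (at z)"
    using z by (intro DERIV_chain2 holomorphic_derivI[OF g_hol open_strip] holomorphic_derivI[OF \<Phi>_hol open_image]) auto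
  then have "((\<lambda>z. z) has_field_derivative deriv \<Phi> (g z) * deriv g z) (at z)"
    by (rule has_field_derivative_transform_within_open[OF _ open_strip z]) (simp add: \<Phi>_g)
  then have "deriv \<Phi> (g z) * deriv g z = 1" by (rule DERIV_unique) (rule DERIV_ident)
  then show ?thesis using deriv_g_nonzero[OF z] by (simp add: f_def field_simps)
qed

lemma
  assumes "w \<in> g ` strip (ereal b)"
  shows image_shift: "w + 1 \<in> g ` strip (ereal b)" and \<Phi>_shift: "\<Phi> (w + 1) = \<Phi> w + 1"
proof -
  obtain z where z: "w = g z" "z \<in> strip (ereal b)" using assms by blast
  have z1: "z + 1 \<in> strip (ereal b)" using z(2) by simp
  have eq: "w + 1 = g (z + 1)" using g_shift[OF z(2)] z(1) by simp
  show "w + 1 \<in> g ` strip (ereal b)" unfolding eq using z1 by (rule imageI)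
  show "\<Phi> (w + 1) = \<Phi> w + 1" unfolding eq by (simp only: \<Phi>_g[OF z1] z(1) \<Phi>_g[OF z(2)])
qed

lemma image_shift_int: "w + of_int k \<in> g ` strip (ereal b)" if w: "w \<in> g ` strip (ereal b)"
proof -
  obtain z where z: "w = g z" "z \<in> strip (ereal b)" using w by blast
  have "g (z + of_int k) = g z + of_int k * 1"
    by (rule periodic_int_shift[where f = g, OF g_shift z(2)])
  then have eq: "w + of_int k = g (z + of_int k)" using z(1) by simp
  show ?thesis unfolding eq by (rule imageI) (use z(2) in simp)
qed

definition A :: "complex \<Rightarrow> complex \<Rightarrow> complex" where "A z t = \<Phi> (g z + t)"

text \<open>\<Phi> is bounded only up to integer translations. So compactness is used on the unit
  rectangle, and the estimate is carried over by integer translations, under which A z t - z - f z t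
  is invariant.\<close>

lemma A_expansion:
  assumes \<sigma>: "0 < \<sigma>" "\<sigma> < b"
  obtains \<delta> M where "\<delta> > 0"
    "\<And>z t. \<bar>Im z\<bar> \<le> \<sigma> \<Longrightarrow> norm t \<le> \<delta> \<Longrightarrow> g z + t \<in> g ` strip (ereal b)"
    "\<And>z t. \<bar>Im z\<bar> \<le> \<sigma> \<Longrightarrow> norm t \<le> \<delta> \<Longrightarrow> norm (A z t - z - f z * t) \<le> M * norm t ^ 2"
proof -
  let ?U = "g ` strip (ereal b)" and ?K = "{z. Re z \<in> {0..1} \<and> \<bar>Im z\<bar> \<le> \<sigma>}"
  have K: "?K \<subseteq> strip (ereal b)" using \<sigma> by auto
  have cK: "compact (g ` ?K)"
    by (rule compact_continuous_image[OF
        continuous_on_subset[OF holomorphic_on_imp_continuous_on[OF g_hol] K] compact_unit_rectangle])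
  have gK: "g ` ?K \<subseteq> ?U" using K by blast
  obtain e where e: "e > 0" "(\<Union>x\<in>g ` ?K. cball x e) \<subseteq> ?U"
    by (rule compact_subset_open_imp_cball_epsilon_subset[OF cK open_image gK])
  define V where "V = (\<Union>x\<in>g ` ?K. cball x e)"
  have "compact (\<Phi> ` V)" unfolding V_def
    by (rule compact_continuous_image[OF continuous_on_subset[OF
        holomorphic_on_imp_continuous_on[OF \<Phi>_hol] e(2)] compact_minkowski_sum_cball[OF cK]])
  then have "bounded (\<Phi> ` V)" by (rule compact_imp_bounded)
  then obtain B where B: "\<And>y. y \<in> V \<Longrightarrow> norm (\<Phi> y) \<le> B"
    by (auto simp: bounded_iff)
  have VU: "V \<subseteq> ?U" using e(2) by (simp add: V_def)
  have base: "g z + t \<in> ?U" "norm (A z t - z - f z * t) \<le> 8 * B / e\<^sup>2 * norm t ^ 2"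
    if "z \<in> ?K" "norm t \<le> e / 2" for z t
  proof -
    have sub: "cball (g z) e \<subseteq> V" unfolding V_def using that(1) by blast
    have "g z + t \<in> cball (g z) e" using that(2) e(1) by (simp add: dist_norm)
    with sub VU show "g z + t \<in> ?U" by blast
    have z: "z \<in> strip (ereal b)" using that(1) K by blast
    have "norm (\<Phi> (g z + t) - \<Phi> (g z) - deriv \<Phi> (g z) * t) \<le> 8 * B / e\<^sup>2 * norm t ^ 2"
      by (rule quadratic_expansion_on_ball[OF \<Phi>_hol open_image e(1) _ _ that(2)]) (use sub VU B in blast)+
    then show "norm (A z t - z - f z * t) \<le> 8 * B / e\<^sup>2 * norm t ^ 2"
      by (simp only: A_def \<Phi>_g[OF z] deriv_\<Phi>[OF z])
  qed
  show ?thesis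
  proof (rule that[of "e / 2" "8 * B / e\<^sup>2"])
    show "e / 2 > 0" using e by simp
    have rep: "g z + t \<in> ?U \<and> norm (A z t - z - f z * t) \<le> 8 * B / e\<^sup>2 * norm t ^ 2"
      if z: "\<bar>Im z\<bar> \<le> \<sigma>" and t: "norm t \<le> e / 2" for z t
    proof -
      obtain w k where w: "z = w + of_int k" "Im w = Im z" "Re w \<in> {0..1}"
        by (rule unit_rectangle_representative)
      have wK: "w \<in> ?K" using w(2,3) z by simp
      then have ws: "w \<in> strip (ereal b)" using K by blast
      have "g (w + of_int k) = g w + of_int k * 1" by (rule periodic_int_shift[where f = g, OF g_shift ws])
      then have gz: "g z + t = (g w + t) + of_int k" by (simp add: w(1))
      obtain v where v: "g w + t = g v" "v \<in> strip (ereal b)" using base(1)[OF wK t] by blast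
      have "g (v + of_int k) = g v + of_int k * 1" by (rule periodic_int_shift[where f = g, OF g_shift v(2)])
      then have "g z + t = g (v + of_int k)" by (simp add: gz v(1))
      moreover have "v + of_int k \<in> strip (ereal b)" using v(2) by simp
      ultimately have "A z t = v + of_int k" by (simp only: A_def \<Phi>_g)
      also have "v = A w t" by (simp only: A_def v(1) \<Phi>_g[OF v(2)])
      finally have Az: "A z t = A w t + of_int k" .
      have "f (w + of_int k) = f w + of_int k * 0" by (rule periodic_int_shift[where b = b]) (use ws f_shift in auto)
      then have fz: "f z = f w" by (simp add: w(1))
      have "A z t - z - f z * t = A w t - w - f w * t" unfolding Az fz by (simp add: w(1))
      then show ?thesis using base[OF wK t] image_shift_int[OF base(1)[OF wK t]] by (simp add: gz)
    qed
    show "g z + t \<in> ?U" if "\<bar>Im z\<bar> \<le> \<sigma>" "norm t \<le> e / 2" for z t using rep[OF that] ..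
    show "norm (A z t - z - f z * t) \<le> 8 * B / e\<^sup>2 * norm t ^ 2"
      if "\<bar>Im z\<bar> \<le> \<sigma>" "norm t \<le> e / 2" for z t using rep[OF that] ..
  qed
qed

lemma near_translation:
  assumes \<sigma>: "0 < \<sigma>" "\<sigma> < b"
  obtains \<delta> K M B m where "near_translation A f \<sigma> \<delta> K M B m"
proof -
  obtain \<delta> M where \<delta>: "\<delta> > 0"
    and U: "\<And>z t. \<bar>Im z\<bar> \<le> \<sigma> \<Longrightarrow> norm t \<le> \<delta> \<Longrightarrow> g z + t \<in> g ` strip (ereal b)"
    and E: "\<And>z t. \<bar>Im z\<bar> \<le> \<sigma> \<Longrightarrow> norm t \<le> \<delta> \<Longrightarrow> norm (A z t - z - f z * t) \<le> M * norm t ^ 2"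
    using A_expansion[OF \<sigma>] by metis
  obtain m where m: "m > 0" "\<And>x::real. Re (f (of_real x)) \<ge> m" using f_real_lower_bound by metis
  define d where "d = (b - \<sigma>) / 2"
  have d: "d > 0" "\<sigma> + d < b" using \<sigma> by (auto simp: d_def field_simps)
  obtain B where B: "B > 0" "\<And>z. \<bar>Im z\<bar> \<le> \<sigma> + d \<Longrightarrow> norm (f z) \<le> B"
    using periodic_bounded_on_strip[OF holomorphic_on_imp_continuous_on[OF f_hol] f_shift d(2)] by metis
  have "near_translation A f \<sigma> \<delta> (B / d) M B m"
  proof
    show "f holomorphic_on strip (ereal \<sigma>)"
      using \<sigma> by (intro holomorphic_on_subset[OF f_hol]) auto
    show "f (z + 1) = f z" if "z \<in> strip (ereal \<sigma>)" for z
      using that \<sigma> by (intro f_shift) auto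
    show "norm (f z - f w) \<le> B / d * norm (z - w)"
      if "z \<in> strip (ereal \<sigma>)" "w \<in> strip (ereal \<sigma>)" for z w
    proof (rule lipschitz_on_strip[OF _ d(1) _ that])
      show "f holomorphic_on strip (ereal (\<sigma> + d))"
        using d by (intro holomorphic_on_subset[OF f_hol]) auto
    qed (use B in auto)
    show "A (z + 1) t = A z t + 1" if "z \<in> strip (ereal \<sigma>)" "norm t \<le> \<delta>" for z t
    proof -
      have "g z + t \<in> g ` strip (ereal b)" using that by (intro U) auto
      moreover have "g (z + 1) + t = (g z + t) + 1" using g_shift[of z] that \<sigma> by simp
      ultimately show ?thesis by (simp only: A_def \<Phi>_shift)
    qed
    show "(\<lambda>x. A (a x) (T x)) holomorphic_on X"
      if "open X" and a: "a holomorphic_on X" and T: "T holomorphic_on X"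
        and ax: "\<And>x. x \<in> X \<Longrightarrow> a x \<in> strip (ereal \<sigma>)" and Tx: "\<And>x. x \<in> X \<Longrightarrow> norm (T x) \<le> \<delta>"
      for X a T
    proof -
      have ga: "(\<lambda>x. g (a x)) holomorphic_on X"
        by (rule holomorphic_on_compose_gen[OF a g_hol, unfolded comp_def]) (use ax \<sigma> in force)
      show ?thesis unfolding A_def
      proof (rule holomorphic_on_compose_gen[OF _ \<Phi>_hol, unfolded comp_def])
        show "(\<lambda>x. g (a x) + T x) holomorphic_on X" by (intro holomorphic_intros ga T)
        show "(\<lambda>x. g (a x) + T x) ` X \<subseteq> g ` strip (ereal b)"
        proof
          fix y assume "y \<in> (\<lambda>x. g (a x) + T x) ` X"
          then obtain x where x: "x \<in> X" "y = g (a x) + T x" by blast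
          show "y \<in> g ` strip (ereal b)" unfolding x(2)
            using ax[OF x(1)] Tx[OF x(1)] by (intro U) auto
        qed
      qed
    qed
  qed (use \<sigma> \<delta> m B d E in auto)
  then show ?thesis by (rule that)
qed

text \<open>Since g (h x + \<theta>) = F x, the map \<open>G\<close> at a real parameter is the
  translated \<open>F\<close> in the coordinate \<open>h\<close>.\<close>

lemma real_orbit:
  fixes t y :: real
  assumes "near_translation A f \<sigma> \<delta> K M B m"
  shows "((near_translation.G A \<theta> (of_real t)) ^^ k) (of_real (h y)) = of_real (h (((\<lambda>x. F x + t) ^^ k) y))"
proof (induction k)
  case (Suc k)
  define x where "x = ((\<lambda>x. F x + t) ^^ k) y"
  have "g (of_real (h x) + of_real \<theta>) + of_real t = of_real (F x + t)"
    using g_h[of "F x"] h_conj[of x] by simp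
  also have "\<dots> = g (of_real (h (F x + t)))" by (simp only: g_h)
  finally have "A (of_real (h x) + of_real \<theta>) (of_real t) = of_real (h (F x + t))"
    using b_pos by (simp add: A_def \<Phi>_g)
  with Suc show ?case by (simp add: x_def near_translation.G_def[OF assms])
qed simp

end

section \<open>Size of the locking sets\<close>

context herman_strip
begin

lemma locking_periodic_point:
  fixes p :: int and q :: nat
  assumes "t \<in> locking_set F (p / q)" "q > 0"
  obtains x :: real where "((\<lambda>x. F x + t) ^^ q) x = x + p"
proof -
  interpret T: circle_map "\<lambda>x. F x + t" by (rule circle_map_translate)
  have "continuous_on UNIV (\<lambda>x. F x + t)"
    by (intro continuous_intros continuous_if_surj surj_F)
  moreover have "trans_num (\<lambda>x. F x + t) = p / q" using assms(1) by (simp add: locking_set_def)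
  ultimately have "\<exists>x::real. ((\<lambda>x. F x + t) ^^ q) x = x + p" using assms(2) by (rule T.periodic_point)
  then show ?thesis using that by blast
qed

lemma locking_set_measure_bound:
  assumes s: "0 < s" "s < b"
  obtains c q0 :: real where "c > 0"
    "\<And>(p::int) (q::nat). q \<ge> q0 \<Longrightarrow> q > 0 \<Longrightarrow> coprime p (int q) \<Longrightarrow> \<bar>q * \<theta> - p\<bar> \<le> 1 / q \<Longrightarrow>
       measure lborel (locking_set F (p / q)) \<le> c / (exp (2 * pi * s * q) - 1)"
proof -
  define \<sigma> d where "\<sigma> = (s + b) / 2" and "d = (\<sigma> - s) / 4"
  have \<sigma>: "0 < \<sigma>" "\<sigma> < b" "s < \<sigma>" using s by (auto simp: \<sigma>_def)
  have d: "d > 0" "s + 4 * d \<le> \<sigma>" using \<sigma> by (simp_all add: d_def field_simps)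
  obtain \<delta> K M B m where nt: "near_translation A f \<sigma> \<delta> K M B m"
    using near_translation[OF \<sigma>(1,2)] by metis
  interpret N: near_translation A f \<theta> \<sigma> \<delta> K M B m by (rule nt)
  define C where "C = K * N.speed + M"
  have C: "C \<ge> 0" using N.K_nonneg N.speed_nonneg N.M_nonneg by (simp add: C_def)
  \<comment> \<open>Chosen from the strips alone, so that it serves every p/q. Adding 1 keeps the
    denominators positive even if \<open>N.speed\<close> or \<open>C\<close> vanishes.\<close>
  define \<epsilon> where "\<epsilon> = min \<delta> (min (d / (16 * (N.speed + 1))) (m / (16 * (C + 1))))"
  have \<epsilon>: "\<epsilon> > 0" "\<epsilon> \<le> \<delta>"
    using N.\<delta>_pos N.m_pos N.speed_nonneg C d by (auto simp: \<epsilon>_def)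
  have \<epsilon>d: "16 * (N.speed * \<epsilon>) \<le> d"
  proof -
    have "\<epsilon> * (16 * (N.speed + 1)) \<le> d"
      using N.speed_nonneg by (subst pos_le_divide_eq[symmetric]) (auto simp: \<epsilon>_def)
    then show ?thesis using \<epsilon>(1) by (simp add: algebra_simps)
  qed
  have \<epsilon>m: "16 * (C * \<epsilon>) \<le> m"
  proof -
    have "\<epsilon> * (16 * (C + 1)) \<le> m"
      using C by (subst pos_le_divide_eq[symmetric]) (auto simp: \<epsilon>_def)
    then show ?thesis using \<epsilon>(1) by (simp add: algebra_simps)
  qed
  define q0 where "q0 = max (6 * K / m) (max (16 / d) (8 / (\<epsilon> * m)))"
  show thesis
  proof (rule that[of "8 * \<epsilon>" q0])
    show "8 * \<epsilon> > 0" using \<epsilon> by simp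
    fix p :: int and q :: nat
    assume q: "q \<ge> q0" "q > 0" and cop: "coprime p (int q)" and approx: "\<bar>q * \<theta> - p\<bar> \<le> 1 / q"
    have "6 * K / m \<le> q" "16 / d \<le> q" "8 / (\<epsilon> * m) \<le> q" using q(1) by (auto simp: q0_def)
    then have qs: "6 * K \<le> real q * m" "16 \<le> real q * d" "8 \<le> \<epsilon> * m * real q"
      using N.m_pos d(1) \<epsilon>(1) by (simp_all add: pos_divide_le_eq mult.commute)
    interpret R: near_resonance A f \<theta> \<sigma> \<delta> K M B m d s \<epsilon> p q
      by unfold_locales (use d s \<epsilon> \<epsilon>d \<epsilon>m qs q(2) cop approx in \<open>simp_all add: C_def\<close>)
    have resonant: "\<bar>t\<bar> \<le> R.\<rho> \<and> (\<exists>x::real. (N.G (of_real t) ^^ q) (of_real x) = of_real x + of_int p \<and>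
        (\<forall>k. (N.G (of_real t) ^^ k) (of_real x) \<in> \<real>))" if t: "t \<in> locking_set F (p / q)" for t
    proof -
      obtain x where x: "((\<lambda>x. F x + t) ^^ q) x = x + p"
        using locking_periodic_point[OF t q(2)] by blast
      note orbit = real_orbit[OF nt]
      \<comment> \<open>For t > \<rho>, monotonicity in the parameter would give F_\<rho>^q(x) \<le>
        x + p, against \<open>above_resonance\<close> in the coordinate \<open>h\<close>.\<close>
      have "t \<le> R.\<rho>"
      proof (rule ccontr)
        assume "\<not> t \<le> R.\<rho>"
        interpret T: circle_map "\<lambda>x. F x + t" by (rule circle_map_translate)
        have "((\<lambda>x. F x + R.\<rho>) ^^ q) x \<le> x + p" unfolding x[symmetric]
          using \<open>\<not> t \<le> R.\<rho>\<close> by (intro funpow_le_funpow T.mono) simp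
        then have "h (((\<lambda>x. F x + R.\<rho>) ^^ q) x) \<le> h x + p"
          unfolding h_shift_int[symmetric] by (rule monoD[OF strict_mono_mono[OF h_mono]])
        with R.above_resonance[of "h x"] show False unfolding orbit by simp
      qed
      moreover have "- R.\<rho> \<le> t"
      proof (rule ccontr)
        assume "\<not> - R.\<rho> \<le> t"
        interpret T: circle_map "\<lambda>x. F x + - R.\<rho>" by (rule circle_map_translate)
        have "x + p \<le> ((\<lambda>x. F x + - R.\<rho>) ^^ q) x" unfolding x[symmetric]
          using \<open>\<not> - R.\<rho> \<le> t\<close> by (intro funpow_le_funpow T.mono) simp
        then have "h x + p \<le> h (((\<lambda>x. F x + - R.\<rho>) ^^ q) x)"
          unfolding h_shift_int[symmetric] by (rule monoD[OF strict_mono_mono[OF h_mono]])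
        with R.below_resonance[of "h x"] show False unfolding orbit by simp
      qed
      moreover have "(N.G (of_real t) ^^ q) (of_real (h x)) = of_real (h x) + of_int p"
        unfolding orbit x h_shift_int by simp
      moreover have "(N.G (of_real t) ^^ k) (of_real (h x)) \<in> \<real>" for k
        unfolding orbit by simp
      ultimately show ?thesis by (auto simp: abs_le_iff)
    qed
    define D where "D = 4 * (R.\<rho> / (exp (2 * pi * s * q) - 1))"
    have e: "exp (2 * pi * s * q) > 1" using s q(2) by simp
    have "measure lborel (locking_set F (p / q)) \<le> 2 * D"
    proof (rule measure_lborel_le_of_diameter)
      show "D \<ge> 0" using e R.\<rho>_pos by (simp add: D_def)
      fix t t' assume "t \<in> locking_set F (p / q)" "t' \<in> locking_set F (p / q)"
      from resonant[OF this(1)] resonant[OF this(2)] show "\<bar>t - t'\<bar> \<le> D"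
        unfolding D_def by (elim conjE exE) (rule R.resonant_parameters_close, auto)
    qed
    also have "2 * D = 8 * R.\<rho> / (exp (2 * pi * s * q) - 1)" by (simp add: D_def)
    also have "\<dots> \<le> 8 * \<epsilon> / (exp (2 * pi * s * q) - 1)"
      using R.\<rho>_le R.\<rho>_pos e by (intro divide_right_mono) auto
    finally show "measure lborel (locking_set F (p / q)) \<le> 8 * \<epsilon> / (exp (2 * pi * s * q) - 1)" .
  qed
qed

text \<open>The constant and the -1 in the denominator are absorbed by applying the previous bound
  at some \<open>s'\<close> between s and b: for large q, exp(2 pi (s' - s) q) is at least c +
  1.\<close>

lemma locking_set_measure_exp_bound:
  assumes s: "0 < s" "s < b"
  obtains q0 :: real where
    "\<And>(p::int) (q::nat). q \<ge> q0 \<Longrightarrow> q > 0 \<Longrightarrow> coprime p (int q) \<Longrightarrow> \<bar>q * \<theta> - p\<bar> \<le> 1 / q \<Longrightarrow>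
       measure lborel (locking_set F (p / q)) \<le> exp (- 2 * pi * s * q)"
proof -
  define s' where "s' = (s + b) / 2"
  have s': "0 < s'" "s' < b" "s < s'" using s by (auto simp: s'_def)
  obtain c q1 :: real where c: "c > 0" and bound:
    "\<And>(p::int) (q::nat). q \<ge> q1 \<Longrightarrow> q > 0 \<Longrightarrow> coprime p (int q) \<Longrightarrow> \<bar>q * \<theta> - p\<bar> \<le> 1 / q \<Longrightarrow>
       measure lborel (locking_set F (p / q)) \<le> c / (exp (2 * pi * s' * q) - 1)"
    using locking_set_measure_bound[OF s'(1,2)] by metis
  show thesis
  proof (rule that[of "max q1 (c / (2 * pi * (s' - s)))"])
    fix p :: int and q :: nat
    assume q: "q \<ge> max q1 (c / (2 * pi * (s' - s)))" "q > 0" and "coprime p (int q)" "\<bar>q * \<theta> - p\<bar> \<le> 1 / q"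
    then have "measure lborel (locking_set F (p / q)) \<le> c / (exp (2 * pi * s' * q) - 1)"
      by (intro bound) auto
    also have "\<dots> \<le> exp (- 2 * pi * s * q)"
    proof -
      have "c / (2 * pi * (s' - s)) \<le> q" using q by simp
      then have "c \<le> 2 * pi * (s' - s) * q" using s' by (simp add: pos_divide_le_eq mult.commute)
      also have "1 + \<dots> \<le> exp (2 * pi * (s' - s) * q)" by (rule exp_ge_add_one_self)
      finally have "c + 1 \<le> exp (2 * pi * (s' - s) * q)" by simp
      moreover have "exp (2 * pi * s' * q) = exp (2 * pi * (s' - s) * q) * exp (2 * pi * s * q)"
        by (simp add: exp_add[symmetric] algebra_simps)
      ultimately have "(c + 1) * exp (2 * pi * s * q) \<le> exp (2 * pi * s' * q)"
        by (simp add: mult_right_mono)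
      moreover have "exp (2 * pi * s * q) \<ge> 1" using s by simp
      ultimately have ge: "c * exp (2 * pi * s * q) \<le> exp (2 * pi * s' * q) - 1"
        unfolding distrib_right by linarith
      have "c / (exp (2 * pi * s' * q) - 1) \<le> c / (c * exp (2 * pi * s * q))"
      proof (rule divide_left_mono[OF ge])
        have "c * exp (2 * pi * s * q) > 0" using c by simp
        moreover from this ge have "exp (2 * pi * s' * q) - 1 > 0" by (rule less_le_trans)
        ultimately show "0 < (exp (2 * pi * s' * q) - 1) * (c * exp (2 * pi * s * q))"
          by (simp only: mult_pos_pos)
      qed (use c in simp)
      also have "\<dots> = exp (- (2 * pi * s * q))" using c by (simp add: exp_minus field_simps)
      finally show ?thesis by simp
    qed
    finally show "measure lborel (locking_set F (p / q)) \<le> exp (- 2 * pi * s * q)" .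
  qed
qed

end

lemma elog_le_if_le_exp:
  assumes "0 \<le> x" "x \<le> exp y"
  shows "elog x \<le> ereal y"
proof (cases "x = 0")
  case False
  then have "ln x \<le> ln (exp y)" using assms by (subst ln_le_cancel_iff) auto
  with False show ?thesis by (simp add: elog_def)
qed (simp add: elog_def)

theorem theorem1:
  fixes F :: "real \<Rightarrow> real" and \<theta> :: real and \<tau> :: ereal and p q :: "nat \<Rightarrow> int"
  assumes "real_analytic_diffeo F"
    and "strict_mono F"
    and "\<And>x. F (x + 1) - (x + 1) = F x - x"
    and "trans_num F = \<theta>"
    and "\<theta> \<notin> \<rat>"
    and "has_herman_ring F"
    and "herman_ring_modulus F (2 * \<tau>)"
    and "\<And>n. real_of_int (p n) / real_of_int (q n) = cf_convergent n \<theta>"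
    and "\<And>n. coprime (p n) (q n)"
    and "\<And>n. q n \<ge> 1"
  shows "limsup (\<lambda>n. ereal (1 / real_of_int (q n)) *
            elog (measure lborel (locking_set F (real_of_int (p n) / real_of_int (q n)))))
         \<le> - (2 * ereal pi * \<tau>)"
    (is "limsup ?X \<le> _")
proof -
  interpret circle_map F
    using assms(2,3) by unfold_locales (auto simp: strict_mono_mono algebra_simps dest: spec)
  obtain \<tau>' where \<tau>': "\<tau>' > 0" "2 * \<tau> = 2 * \<tau>'" "extends_univalently (inv (lin_map F)) \<tau>'"
    using assms(7) by (auto simp: herman_ring_modulus_def)
  have "\<tau> = \<tau>'" using \<tau>'(2) by (cases \<tau>; cases \<tau>') (auto simp: ereal_mult_cancel_left)
  with \<tau>' have \<tau>: "\<tau> > 0" "extends_univalently (inv (lin_map F)) \<tau>" by auto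
  obtain g where g: "g holomorphic_on strip \<tau>" "inj_on g (strip \<tau>)"
    "\<And>x::real. g (of_real x) = of_real (inv (lin_map F) x)"
    using \<tau>(2) by (auto simp: extends_univalently_def)
  have bound: "limsup ?X \<le> ereal (- 2 * pi * s)" if s: "s > 0" "ereal s < \<tau>" for s :: real
  proof -
    obtain b where b: "s < b" "ereal b < \<tau>"
      using ereal_dense2[OF s(2)] by auto
    have sub: "strip (ereal b) \<subseteq> strip \<tau>"
    proof
      fix z assume "z \<in> strip (ereal b)"
      then have "ereal \<bar>Im z\<bar> < ereal b" by (simp add: strip_def)
      also note b(2)
      finally show "z \<in> strip \<tau>" by (simp add: strip_def)
    qed
    interpret herman_strip F \<theta> b g
    proof
      show "surj F" "bij (lin_map F)"
        using assms(1,6) by (auto simp: real_analytic_diffeo_def has_herman_ring_def bij_is_surj)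
      show "g holomorphic_on strip (ereal b)" by (rule holomorphic_on_subset[OF g(1) sub])
      show "inj_on g (strip (ereal b))" by (rule inj_on_subset[OF g(2) sub])
    qed (use assms(4) g(3) s b in auto)
    obtain q0 :: real where q0: "\<And>(p::int) (q::nat). q \<ge> q0 \<Longrightarrow> q > 0 \<Longrightarrow> coprime p (int q) \<Longrightarrow>
        \<bar>q * \<theta> - p\<bar> \<le> 1 / q \<Longrightarrow> measure lborel (locking_set F (p / q)) \<le> exp (- 2 * pi * s * q)"
      using locking_set_measure_exp_bound[OF s(1) b(1)] by metis
    \<comment> \<open>As q_n \<ge> n, all indices beyond \<open>q0\<close> have a large enough
      denominator.\<close>
    have "?X n \<le> ereal (- 2 * pi * s)" if n: "n \<ge> nat \<lceil>q0\<rceil>" for n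
    proof -
      define k where "k = nat (q n)"
      have k: "q n = int k" "k > 0" using assms(10)[of n] by (auto simp: k_def)
      note cf = cf_convergent_approximation[OF assms(5,8,9,10), of n]
      have "q0 \<le> k" using cf(2) n k by linarith
      then have "measure lborel (locking_set F (p n / q n)) \<le> exp (- 2 * pi * s * k)"
        using q0[of k "p n"] k cf(1) assms(9)[of n] by simp
      then have "elog (measure lborel (locking_set F (p n / q n))) \<le> ereal (- 2 * pi * s * k)"
        by (intro elog_le_if_le_exp) auto
      then have "?X n \<le> ereal (1 / q n) * ereal (- 2 * pi * s * k)"
        using k by (intro ereal_mult_left_mono) auto
      also have "\<dots> = ereal (- 2 * pi * s)" using k by simp
      finally show ?thesis .
    qed
    then show ?thesis
      by (intro Limsup_bounded eventually_sequentiallyI)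
  qed
  show ?thesis
  proof (cases \<tau>)
    case (real r)
    then have r: "r > 0" using \<tau>(1) by simp
    show ?thesis
    proof (rule ereal_le_epsilon2)
      fix e :: real assume e: "e > 0"
      \<comment> \<open>The maximum with r/2 keeps s positive when e is large.\<close>
      define s where "s = max (r / 2) (r - e / (2 * pi))"
      have s: "s > 0" "s < r" using r e by (auto simp: s_def)
      have "r - e / (2 * pi) \<le> s" by (simp add: s_def)
      then have "2 * pi * (r - e / (2 * pi)) \<le> 2 * pi * s" by (intro mult_left_mono) auto
      then have "- 2 * pi * s \<le> - (2 * pi * r) + e" by (simp add: right_diff_distrib)
      then have "ereal (- 2 * pi * s) \<le> - (2 * ereal pi * \<tau>) + ereal e" by (simp add: real)
      with bound[of s] s real show "limsup ?X \<le> - (2 * ereal pi * \<tau>) + ereal e"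
        by (auto intro: order_trans)
    qed
  next
    case PInf
    \<comment> \<open>For infinite \<tau> every s > 0 is admissible, and s is taken so large that -2
      pi s \<le> B.\<close>
    have "limsup ?X \<le> ereal B" for B
    proof -
      define s where "s = max 1 (- B / (2 * pi))"
      have "- B / (2 * pi) \<le> s" by (simp add: s_def)
      then have "- B \<le> s * (2 * pi)" by (subst (asm) pos_divide_le_eq) auto
      then have "- 2 * pi * s \<le> B" by (simp add: mult.commute)
      moreover have "limsup ?X \<le> ereal (- 2 * pi * s)" proof (rule bound)
        show "s > 0" unfolding s_def by (rule less_le_trans[OF zero_less_one max.cobounded1])
      qed (simp add: PInf)
      ultimately show ?thesis by (auto intro: order_trans)
    qed
    then have "limsup ?X = - \<infinity>" by (rule ereal_bot)
    then show ?thesis by simp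
  qed (use \<tau> in auto)
qed

end
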